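(* Let $P$ be a connected finite $\Gamma$-colored minuscule poset and assume $\Gamma$ is simply laced and contains more than one color. If $P$ is slant irreducible as a $\Gamma$-colored $d$-complete poset, then $P$ has type $A$ exterior, type $D$ standard, type $D$ spin, type $E_6$, or type $E_7$.
   Context: Dynkin diagram $\Gamma$: finite set with integers $\theta_{ab}$, $\theta_{aa}=2$, $\theta_{ab}\le0$ ($a\ne b$), $\theta_{ab}=0\iff\theta_{ba}=0$; $a\sim b$ if $a\ne b$ and $\theta_{ab}<0$; simply laced: all $\theta_{ab}\in\{-1,0,2\}$. $\Gamma$-colored poset: poset with surjective $\kappa:P\to\Gamma$; isomorphism: poset isomorphism $\pi$ and $\theta$-preserving bijection $\gamma$ with $\kappa_2\pi=\gamma\kappa_1$. Consecutive elements of color $a$: $x<y$ of color $a$, no color-$a$ element in $(x,y)$. $U(x,P)=\{y>x:\kappa(y)\sim\kappa(x)\}$, $L(x,P)=\{y<x:\kappa(y)\sim\kappa(x)\}$. $\Gamma$-colored $d$-complete: locally finite with (EC) equal colors comparable; (NA) neighbors (one covers the other) have adjacent colors; (AC) adjacent colors comparable; (ICE2) consecutive $x<y$ of color $a$ have $\sum_{z\in(x,y)}-\theta_{\kappa(z),a}=2$; (UCB1) for maximal $x$ of color $a$, $U(x,P)$ finite and $\sum_{y\in U(x,P)}-\theta_{\kappa(y),a}\le1$. $\Gamma$-colored minuscule: additionally (LCB1) for minimal $x$ of color $a$, $L(x,P)$ finite, $\sum_{y\in L(x,P)}-\theta_{\kappa(y),a}\le1$. Top tree $T$ of finite $P$: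 elements maximal in their color class. $P$ is slant irreducible if connected and whenever $x,y\in T$ with $y$ covering $x$, $y$ is not the only element of its color in $P$. Types ("has type X" = isomorphic to the listed poset for some allowed $n$; $u\succ v$ means $u$ covers $v$): $A$ exterior: for $1<m<n$, $\Gamma$ the simply laced path $c_1\sim\cdots\sim c_n$; poset $\{1..m\}\times\{1..n+1-m\}$, componentwise order, $\kappa(p,q)=c_{p-q+n+1-m}$. $D$ standard ($n\ge4$): nodes $c_1..c_n$, adjacencies $c_s\sim c_{s+1}$ ($s\le n-3$), $c_{n-2}\sim c_{n-1}$, $c_{n-2}\sim c_n$; poset on $x_1..x_{n-2},y,z,x'_1..x'_{n-2}$, covers exactly $x_s\succ x_{s+1}$, $x'_{s+1}\succ x'_s$ ($s\le n-3$), $x_{n-2}\succ y,z$, $y,z\succ x'_{n-2}$; $\kappa(x_s)=\kappa(x'_s)=c_s$, $\kappa(y)=c_{n-1}$, $\kappa(z)=c_n$. $D$ spin ($n\ge5$): nodes $c_0,c_0',c_1..c_{n-2}$, adjacencies $c_0\sim c_1$, $c_0'\sim c_1$, $c_s\sim c_{s+1}$ ($1\le s\le n-3$); poset $\{(u,v):0\le u\le v\le n-2\}$ with $(u,v)\le(u',v')$ iff $u\ge u'$ and $v\ge v'$; color $c_{v-u}$ if $v>u$, $c_0$ if $v=u$ even, $c_0'$ if $v=u$ odd. $E_6$: nodes $a..f$, adjacencies $a\sim b\sim c\sim d\sim e$, $c\sim f$; 16 elements (letter=color) with covers exactly $a_1\succ b_1$, $b_1\succ c_1$, $c_1\succ d_1,f_1$,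 $d_1\succ e_1,c_2$, $f_1\succ c_2$, $e_1\succ d_2$, $c_2\succ d_2,b_2$, $d_2\succ c_3$, $b_2\succ c_3,a_2$, $c_3\succ b_3,f_2$, $a_2\succ b_3$, $b_3\succ c_4$, $f_2\succ c_4$, $c_4\succ d_3$, $d_3\succ e_2$. $E_7$: nodes $a..g$, adjacencies $a\sim b\sim c\sim d\sim e\sim f$, $d\sim g$; 27 elements (letter=color) with covers exactly $a_1\succ b_1$, $b_1\succ c_1$, $c_1\succ d_1$, $d_1\succ e_1,g_1$, $e_1\succ f_1,d_2$, $g_1\succ d_2$, $f_1\succ e_2$, $d_2\succ e_2,c_2$, $e_2\succ d_3$, $c_2\succ d_3,b_2$, $d_3\succ g_2,c_3$, $b_2\succ c_3,a_2$, $c_3\succ d_4,b_3$, $g_2\succ d_4$, $a_2\succ b_3$, $d_4\succ e_3,c_4$, $b_3\succ c_4$, $e_3\succ f_2,d_5$, $c_4\succ d_5$, $f_2\succ e_4$, $d_5\succ e_4,g_3$, $e_4\succ d_6$, $g_3\succ d_6$, $d_6\succ c_5$, $c_5\succ b_4$, $b_4\succ a_3$. *)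

theory Defs
  imports Main
begin

(* A poset together with a Dynkin diagram and a coloring; the order is the relation \<le> on the
   elements, as a set of pairs (x, y) with x \<le> y.  Values of theta outside the set of colors and
   values of color outside the set of elements are irrelevant. *)
record ('a, 'c) colored_poset =
  elems :: "'a set"
  ord :: "'a rel"
  colors :: "'c set"
  theta :: "'c \<Rightarrow> 'c \<Rightarrow> int"
  color :: "'a \<Rightarrow> 'c"


section \<open>Dynkin diagrams and colored posets\<close>

definition dynkin_diagram :: "'c set \<Rightarrow> ('c \<Rightarrow> 'c \<Rightarrow> int) \<Rightarrow> bool" where
  "dynkin_diagram G th \<longleftrightarrow>
     finite G \<and>
     (\<forall>a\<in>G. th a a = 2) \<and>
     (\<forall>a\<in>G. \<forall>b\<in>G. a \<noteq> b \<longrightarrow> th a b \<le> 0) \<and>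
     (\<forall>a\<in>G. \<forall>b\<in>G. th a b = 0 \<longleftrightarrow> th b a = 0)"

definition simply_laced :: "'c set \<Rightarrow> ('c \<Rightarrow> 'c \<Rightarrow> int) \<Rightarrow> bool" where
  "simply_laced G th \<longleftrightarrow> (\<forall>a\<in>G. \<forall>b\<in>G. th a b \<in> {-1, 0, 2})"

definition adjacent :: "('c \<Rightarrow> 'c \<Rightarrow> int) \<Rightarrow> 'c \<Rightarrow> 'c \<Rightarrow> bool" where
  "adjacent th a b \<longleftrightarrow> a \<noteq> b \<and> th a b < 0"

definition gamma_colored_poset :: "('a, 'c) colored_poset \<Rightarrow> bool" where
  "gamma_colored_poset P \<longleftrightarrow>
     dynkin_diagram (colors P) (theta P) \<and>
     partial_order_on (elems P) (ord P) \<and>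
     color P ` elems P = colors P"

definition gamma_isomorphic :: "('a, 'c) colored_poset \<Rightarrow> ('b, 'd) colored_poset \<Rightarrow> bool" where
  "gamma_isomorphic P Q \<longleftrightarrow>
     (\<exists>\<pi> \<gamma>. bij_betw \<pi> (elems P) (elems Q) \<and>
            (\<forall>x\<in>elems P. \<forall>y\<in>elems P. (\<pi> x, \<pi> y) \<in> ord Q \<longleftrightarrow> (x, y) \<in> ord P) \<and>
            bij_betw \<gamma> (colors P) (colors Q) \<and>
            (\<forall>a\<in>colors P. \<forall>b\<in>colors P. theta Q (\<gamma> a) (\<gamma> b) = theta P a b) \<and>
            (\<forall>x\<in>elems P. color Q (\<pi> x) = \<gamma> (color P x)))"

definition less_in :: "('a, 'c) colored_poset \<Rightarrow> 'a \<Rightarrow> 'a \<Rightarrow> bool" where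
  "less_in P x y \<longleftrightarrow> x \<in> elems P \<and> y \<in> elems P \<and> (x, y) \<in> ord P \<and> x \<noteq> y"

definition comparable :: "('a, 'c) colored_poset \<Rightarrow> 'a \<Rightarrow> 'a \<Rightarrow> bool" where
  "comparable P x y \<longleftrightarrow> (x, y) \<in> ord P \<or> (y, x) \<in> ord P"

definition closed_interval :: "('a, 'c) colored_poset \<Rightarrow> 'a \<Rightarrow> 'a \<Rightarrow> 'a set" where
  "closed_interval P x y = {z \<in> elems P. (x, z) \<in> ord P \<and> (z, y) \<in> ord P}"

definition open_interval :: "('a, 'c) colored_poset \<Rightarrow> 'a \<Rightarrow> 'a \<Rightarrow> 'a set" where
  "open_interval P x y = {z. less_in P x z \<and> less_in P z y}"

definition covered_by :: "('a, 'c) colored_poset \<Rightarrow> 'a \<Rightarrow> 'a \<Rightarrow> bool" where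
  "covered_by P x y \<longleftrightarrow> less_in P x y \<and> open_interval P x y = {}"

definition neighbors :: "('a, 'c) colored_poset \<Rightarrow> 'a \<Rightarrow> 'a \<Rightarrow> bool" where
  "neighbors P x y \<longleftrightarrow> covered_by P x y \<or> covered_by P y x"

definition locally_finite :: "('a, 'c) colored_poset \<Rightarrow> bool" where
  "locally_finite P \<longleftrightarrow> (\<forall>x\<in>elems P. \<forall>y\<in>elems P. finite (closed_interval P x y))"

(* Connectedness of the Hasse diagram. *)
definition connected_poset :: "('a, 'c) colored_poset \<Rightarrow> bool" where
  "connected_poset P \<longleftrightarrow>
     (\<forall>x\<in>elems P. \<forall>y\<in>elems P. (x, y) \<in> {(u, v). neighbors P u v}\<^sup>*)"


section \<open>d-complete and minuscule posets\<close>

definition consecutive :: "('a, 'c) colored_poset \<Rightarrow> 'c \<Rightarrow> 'a \<Rightarrow> 'a \<Rightarrow> bool" where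
  "consecutive P a x y \<longleftrightarrow>
     less_in P x y \<and> color P x = a \<and> color P y = a \<and>
     (\<forall>z\<in>open_interval P x y. color P z \<noteq> a)"

definition maximal_in_color :: "('a, 'c) colored_poset \<Rightarrow> 'a \<Rightarrow> bool" where
  "maximal_in_color P x \<longleftrightarrow>
     x \<in> elems P \<and> \<not> (\<exists>y\<in>elems P. color P y = color P x \<and> less_in P x y)"

definition minimal_in_color :: "('a, 'c) colored_poset \<Rightarrow> 'a \<Rightarrow> bool" where
  "minimal_in_color P x \<longleftrightarrow>
     x \<in> elems P \<and> \<not> (\<exists>y\<in>elems P. color P y = color P x \<and> less_in P y x)"

definition upper_adjacent :: "('a, 'c) colored_poset \<Rightarrow> 'a \<Rightarrow> 'a set" where
  "upper_adjacent P x = {y. less_in P x y \<and> adjacent (theta P) (color P y) (color P x)}"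

definition lower_adjacent :: "('a, 'c) colored_poset \<Rightarrow> 'a \<Rightarrow> 'a set" where
  "lower_adjacent P x = {y. less_in P y x \<and> adjacent (theta P) (color P y) (color P x)}"

definition EC :: "('a, 'c) colored_poset \<Rightarrow> bool" where
  "EC P \<longleftrightarrow> (\<forall>x\<in>elems P. \<forall>y\<in>elems P. color P x = color P y \<longrightarrow> comparable P x y)"

definition NA :: "('a, 'c) colored_poset \<Rightarrow> bool" where
  "NA P \<longleftrightarrow> (\<forall>x\<in>elems P. \<forall>y\<in>elems P.
     neighbors P x y \<longrightarrow> adjacent (theta P) (color P x) (color P y))"

definition AC :: "('a, 'c) colored_poset \<Rightarrow> bool" where
  "AC P \<longleftrightarrow> (\<forall>x\<in>elems P. \<forall>y\<in>elems P.
     adjacent (theta P) (color P x) (color P y) \<longrightarrow> comparable P x y)"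

definition ICE2 :: "('a, 'c) colored_poset \<Rightarrow> bool" where
  "ICE2 P \<longleftrightarrow> (\<forall>a\<in>colors P. \<forall>x\<in>elems P. \<forall>y\<in>elems P. consecutive P a x y \<longrightarrow>
     (\<Sum>z\<in>open_interval P x y. - theta P (color P z) a) = 2)"

(* In UCB1 and LCB1, maximal and minimal are meant within the color class of x. *)
definition UCB1 :: "('a, 'c) colored_poset \<Rightarrow> bool" where
  "UCB1 P \<longleftrightarrow> (\<forall>x. maximal_in_color P x \<longrightarrow>
     finite (upper_adjacent P x) \<and>
     (\<Sum>y\<in>upper_adjacent P x. - theta P (color P y) (color P x)) \<le> 1)"

definition LCB1 :: "('a, 'c) colored_poset \<Rightarrow> bool" where
  "LCB1 P \<longleftrightarrow> (\<forall>x. minimal_in_color P x \<longrightarrow>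
     finite (lower_adjacent P x) \<and>
     (\<Sum>y\<in>lower_adjacent P x. - theta P (color P y) (color P x)) \<le> 1)"

definition gamma_colored_d_complete :: "('a, 'c) colored_poset \<Rightarrow> bool" where
  "gamma_colored_d_complete P \<longleftrightarrow>
     gamma_colored_poset P \<and> locally_finite P \<and>
     EC P \<and> NA P \<and> AC P \<and> ICE2 P \<and> UCB1 P"

definition gamma_colored_minuscule :: "('a, 'c) colored_poset \<Rightarrow> bool" where
  "gamma_colored_minuscule P \<longleftrightarrow> gamma_colored_d_complete P \<and> LCB1 P"

definition top_tree :: "('a, 'c) colored_poset \<Rightarrow> 'a set" where
  "top_tree P = {x. maximal_in_color P x}"

definition slant_irreducible :: "('a, 'c) colored_poset \<Rightarrow> bool" where
  "slant_irreducible P \<longleftrightarrow>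
     connected_poset P \<and>
     (\<forall>x\<in>top_tree P. \<forall>y\<in>top_tree P. covered_by P x y \<longrightarrow>
        (\<exists>w\<in>elems P. w \<noteq> y \<and> color P w = color P y))"


section \<open>The listed posets\<close>

(* The edges of a simply laced diagram need only be listed in one direction. *)
definition edge_theta :: "('c \<times> 'c) set \<Rightarrow> 'c \<Rightarrow> 'c \<Rightarrow> int" where
  "edge_theta E a b =
     (if a = b then 2 else if (a, b) \<in> E \<or> (b, a) \<in> E then -1 else 0)"

(* The order on S whose covers are the listed pairs; a pair (u, v) means that u covers v. *)
definition order_of_covers :: "'a set \<Rightarrow> ('a \<times> 'a) set \<Rightarrow> 'a rel" where
  "order_of_covers S C = {(x, y). x \<in> S \<and> y \<in> S \<and> (y, x) \<in> C\<^sup>*}"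

(* The color index p - q + n + 1 - m is written so that no natural number subtraction truncates. *)
definition A_exterior :: "nat \<Rightarrow> nat \<Rightarrow> (nat \<times> nat, nat) colored_poset" where
  "A_exterior m n = \<lparr>
     elems = {1..m} \<times> {1..n + 1 - m},
     ord = {((p, q), (p', q')).
              (p, q) \<in> {1..m} \<times> {1..n + 1 - m} \<and> (p', q') \<in> {1..m} \<times> {1..n + 1 - m} \<and>
              p \<le> p' \<and> q \<le> q'},
     colors = {1..n},
     theta = edge_theta {(s, s + 1) | s. 1 \<le> s \<and> s + 1 \<le> n},
     color = (\<lambda>(p, q). p + (n + 1 - m) - q)\<rparr>"

(* X' s stands for the element x'_s, and the color i for the node c_i. *)
datatype D_std_elem = X nat | Y | Z | X' nat

fun D_std_color :: "nat \<Rightarrow> D_std_elem \<Rightarrow> nat" where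
  "D_std_color n (X s) = s"
| "D_std_color n Y = n - 1"
| "D_std_color n Z = n"
| "D_std_color n (X' s) = s"

definition D_std_elems :: "nat \<Rightarrow> D_std_elem set" where
  "D_std_elems n = X ` {1..n - 2} \<union> {Y, Z} \<union> X' ` {1..n - 2}"

definition D_std_covers :: "nat \<Rightarrow> (D_std_elem \<times> D_std_elem) set" where
  "D_std_covers n =
     {(X s, X (s + 1)) | s. 1 \<le> s \<and> s \<le> n - 3} \<union>
     {(X' (s + 1), X' s) | s. 1 \<le> s \<and> s \<le> n - 3} \<union>
     {(X (n - 2), Y), (X (n - 2), Z), (Y, X' (n - 2)), (Z, X' (n - 2))}"

definition D_standard :: "nat \<Rightarrow> (D_std_elem, nat) colored_poset" where
  "D_standard n = \<lparr>
     elems = D_std_elems n,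
     ord = order_of_covers (D_std_elems n) (D_std_covers n),
     colors = {1..n},
     theta = edge_theta
       ({(s, s + 1) | s. 1 \<le> s \<and> s \<le> n - 3} \<union> {(n - 2, n - 1), (n - 2, n)}),
     color = D_std_color n\<rparr>"

(* C0 and C0' are the two spin nodes; C s with 1 \<le> s \<le> n - 2 are the remaining ones. *)
datatype D_spin_node = C0 | C0' | C nat

definition D_spin_elems :: "nat \<Rightarrow> (nat \<times> nat) set" where
  "D_spin_elems n = {(u, v). u \<le> v \<and> v \<le> n - 2}"

definition D_spin :: "nat \<Rightarrow> (nat \<times> nat, D_spin_node) colored_poset" where
  "D_spin n = \<lparr>
     elems = D_spin_elems n,
     ord = {((u, v), (u', v')).
              (u, v) \<in> D_spin_elems n \<and> (u', v') \<in> D_spin_elems n \<and> u \<ge> u' \<and> v \<ge> v'},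
     colors = {C0, C0'} \<union> C ` {1..n - 2},
     theta = edge_theta
       ({(C0, C 1), (C0', C 1)} \<union> {(C s, C (s + 1)) | s. 1 \<le> s \<and> s \<le> n - 3}),
     color = (\<lambda>(u, v). if u < v then C (v - u) else if even u then C0 else C0')\<rparr>"

(* In types E6 and E7 the element a_1 is the pair (Na, 1), and so on. *)
datatype E_node = Na | Nb | Nc | Nd | Ne | Nf | Ng

definition E6_elems :: "(E_node \<times> nat) set" where
  "E6_elems = {Na} \<times> {1..2} \<union> {Nb} \<times> {1..3} \<union> {Nc} \<times> {1..4} \<union> {Nd} \<times> {1..3} \<union>
     {Ne} \<times> {1..2} \<union> {Nf} \<times> {1..2}"

definition E6_covers :: "((E_node \<times> nat) \<times> (E_node \<times> nat)) set" where
  "E6_covers =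
     {((Na, 1), (Nb, 1)), ((Nb, 1), (Nc, 1)), ((Nc, 1), (Nd, 1)), ((Nc, 1), (Nf, 1)),
      ((Nd, 1), (Ne, 1)), ((Nd, 1), (Nc, 2)), ((Nf, 1), (Nc, 2)), ((Ne, 1), (Nd, 2)),
      ((Nc, 2), (Nd, 2)), ((Nc, 2), (Nb, 2)), ((Nd, 2), (Nc, 3)), ((Nb, 2), (Nc, 3)),
      ((Nb, 2), (Na, 2)), ((Nc, 3), (Nb, 3)), ((Nc, 3), (Nf, 2)), ((Na, 2), (Nb, 3)),
      ((Nb, 3), (Nc, 4)), ((Nf, 2), (Nc, 4)), ((Nc, 4), (Nd, 3)), ((Nd, 3), (Ne, 2))}"

definition E6 :: "(E_node \<times> nat, E_node) colored_poset" where
  "E6 = \<lparr>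
     elems = E6_elems,
     ord = order_of_covers E6_elems E6_covers,
     colors = {Na, Nb, Nc, Nd, Ne, Nf},
     theta = edge_theta {(Na, Nb), (Nb, Nc), (Nc, Nd), (Nd, Ne), (Nc, Nf)},
     color = fst\<rparr>"

definition E7_elems :: "(E_node \<times> nat) set" where
  "E7_elems = {Na} \<times> {1..3} \<union> {Nb} \<times> {1..4} \<union> {Nc} \<times> {1..5} \<union> {Nd} \<times> {1..6} \<union>
     {Ne} \<times> {1..4} \<union> {Nf} \<times> {1..2} \<union> {Ng} \<times> {1..3}"

definition E7_covers :: "((E_node \<times> nat) \<times> (E_node \<times> nat)) set" where
  "E7_covers =
     {((Na, 1), (Nb, 1)), ((Nb, 1), (Nc, 1)), ((Nc, 1), (Nd, 1)), ((Nd, 1), (Ne, 1)),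
      ((Nd, 1), (Ng, 1)), ((Ne, 1), (Nf, 1)), ((Ne, 1), (Nd, 2)), ((Ng, 1), (Nd, 2)),
      ((Nf, 1), (Ne, 2)), ((Nd, 2), (Ne, 2)), ((Nd, 2), (Nc, 2)), ((Ne, 2), (Nd, 3)),
      ((Nc, 2), (Nd, 3)), ((Nc, 2), (Nb, 2)), ((Nd, 3), (Ng, 2)), ((Nd, 3), (Nc, 3)),
      ((Nb, 2), (Nc, 3)), ((Nb, 2), (Na, 2)), ((Nc, 3), (Nd, 4)), ((Nc, 3), (Nb, 3)),
      ((Ng, 2), (Nd, 4)), ((Na, 2), (Nb, 3)), ((Nd, 4), (Ne, 3)), ((Nd, 4), (Nc, 4)),
      ((Nb, 3), (Nc, 4)), ((Ne, 3), (Nf, 2)), ((Ne, 3), (Nd, 5)), ((Nc, 4), (Nd, 5)),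
      ((Nf, 2), (Ne, 4)), ((Nd, 5), (Ne, 4)), ((Nd, 5), (Ng, 3)), ((Ne, 4), (Nd, 6)),
      ((Ng, 3), (Nd, 6)), ((Nd, 6), (Nc, 5)), ((Nc, 5), (Nb, 4)), ((Nb, 4), (Na, 3))}"

definition E7 :: "(E_node \<times> nat, E_node) colored_poset" where
  "E7 = \<lparr>
     elems = E7_elems,
     ord = order_of_covers E7_elems E7_covers,
     colors = {Na, Nb, Nc, Nd, Ne, Nf, Ng},
     theta = edge_theta {(Na, Nb), (Nb, Nc), (Nc, Nd), (Nd, Ne), (Ne, Nf), (Nd, Ng)},
     color = fst\<rparr>"

definition has_type_A_exterior :: "('a, 'c) colored_poset \<Rightarrow> bool" where
  "has_type_A_exterior P \<longleftrightarrow> (\<exists>m n. 1 < m \<and> m < n \<and> gamma_isomorphic P (A_exterior m n))"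

definition has_type_D_standard :: "('a, 'c) colored_poset \<Rightarrow> bool" where
  "has_type_D_standard P \<longleftrightarrow> (\<exists>n\<ge>4. gamma_isomorphic P (D_standard n))"

definition has_type_D_spin :: "('a, 'c) colored_poset \<Rightarrow> bool" where
  "has_type_D_spin P \<longleftrightarrow> (\<exists>n\<ge>5. gamma_isomorphic P (D_spin n))"

definition has_type_E6 :: "('a, 'c) colored_poset \<Rightarrow> bool" where
  "has_type_E6 P \<longleftrightarrow> gamma_isomorphic P E6"

definition has_type_E7 :: "('a, 'c) colored_poset \<Rightarrow> bool" where
  "has_type_E7 P \<longleftrightarrow> gamma_isomorphic P E7"

end

theory Submission
  imports Defs
begin

text \<open>
  A filter F of P is a position of the numbers game on the Dynkin diagram: the weight of a color
  starts at 1 for the color of the maximal element and at 0 for all others, and each element of F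
  subtracts a row of the Cartan matrix.  The axioms say that weights never exceed 1, that a color
  has weight 1 exactly when the next element of this color can be added to F, and that F = P once
  no weight is positive.  Hence P is determined by its diagram and the color of its maximal
  element.  The diagram is the top tree, rooted at that color.  Playing on a subtree of
  descendants starts from weight 1 at its root and 0 elsewhere, so a subtree on which the game
  reaches a weight 2 cannot occur.  This excludes a node with three children, two nodes with two
  children each, and the adjoint rootings of E6, E7 and E8; what remains is the rooted trees of
  the listed posets and chains.  On a chain P is its own top tree, against slant irreducibility.
\<close>


text \<open>A position is a weight in fundamental coordinates, and a move at a color of weight 1 is
  the simple reflection there, subtracting one simple root. A weight is minuscule when no coordinate
  on its orbit exceeds 1. An adjoint rooting violates this because its starting weight is the
  highest root: each move lowers the height by one, and when height 1 is reached a simple root is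
  left, whose coordinate at its own node is 2. The move sequences come from there: 10, 16 and 28
  moves for the heights 11, 17 and 29 of E6, E7 and E8. The exclusions of three children and of two
  branching nodes are the same descent in D4 and D_n.

  Each axiom has its place: UCB1 gives the starting position and unique parents, ICE2 carries the
  value 1 from one element of a color to the next, AC and EC discard incomparable elements, NA makes
  a weight 1 playable, and LCB1 ends the moves of a color after its last element. Uniqueness of P
  holds because the place of a new element relative to a filter is forced by its color: it lies
  below the elements of adjacent colors and whatever is above those.\<close>

locale minuscule_game =
  fixes P :: "('a, 'c) colored_poset"
  assumes minuscule: "gamma_colored_minuscule P"
    and fin: "finite (elems P)"
    and conn: "connected_poset P"
    and laced: "simply_laced (colors P) (theta P)"
begin

section \<open>Order and color basics in the simply laced finite case\<close>

abbreviation lt :: "'a \<Rightarrow> 'a \<Rightarrow> bool"  (infix \<open>\<prec>\<close> 50) where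
  "x \<prec> y \<equiv> less_in P x y"

abbreviation col :: "'a \<Rightarrow> 'c" where
  "col \<equiv> color P"

abbreviation th :: "'c \<Rightarrow> 'c \<Rightarrow> int" where
  "th \<equiv> theta P"

lemma d_complete: "gamma_colored_d_complete P" and lcb1: "LCB1 P"
  using minuscule by (auto simp: gamma_colored_minuscule_def)

lemma colored: "gamma_colored_poset P" and ec: "EC P" and na: "NA P" and ac: "AC P"
  and ice2: "ICE2 P" and ucb1: "UCB1 P"
  using d_complete by (auto simp: gamma_colored_d_complete_def)

lemma po: "partial_order_on (elems P) (ord P)" and dynkin: "dynkin_diagram (colors P) th"
  and col_image: "col ` elems P = colors P"
  using colored by (auto simp: gamma_colored_poset_def)

lemma col_in [simp]: "x \<in> elems P \<Longrightarrow> col x \<in> colors P"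
  using col_image by auto

lemma finite_colors [simp]: "finite (colors P)"
  using dynkin by (auto simp: dynkin_diagram_def)

lemma ord_refl: "x \<in> elems P \<Longrightarrow> (x, x) \<in> ord P"
  using po by (auto simp: partial_order_on_def preorder_on_def refl_on_def)

lemma ltD: "x \<prec> y \<Longrightarrow> x \<in> elems P \<and> y \<in> elems P \<and> (x, y) \<in> ord P \<and> x \<noteq> y"
  by (simp add: less_in_def)

lemma lt_irrefl [simp]: "\<not> x \<prec> x"
  by (simp add: less_in_def)

lemma lt_trans: "x \<prec> y \<Longrightarrow> y \<prec> z \<Longrightarrow> x \<prec> z"
  using po unfolding less_in_def partial_order_on_def preorder_on_def
  by (meson antisymD transD)

lemma lt_asym: "x \<prec> y \<Longrightarrow> \<not> y \<prec> x"
  using lt_trans lt_irrefl by blast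

lemma finite_lt [simp]: "finite {z. x \<prec> z}" "finite {z. z \<prec> x}"
  by (rule finite_subset[OF _ fin], auto dest: ltD)+

lemma card_up_less:
  assumes "x \<prec> y" shows "card {z. y \<prec> z} < card {z. x \<prec> z}"
proof (rule psubset_card_mono)
  show "{z. y \<prec> z} \<subset> {z. x \<prec> z}"
    using assms lt_trans[of x y] lt_irrefl[of y] by blast
qed simp

lemma card_down_less:
  assumes "x \<prec> y" shows "card {z. z \<prec> x} < card {z. z \<prec> y}"
proof (rule psubset_card_mono)
  show "{z. z \<prec> x} \<subset> {z. z \<prec> y}"
    using assms lt_trans[of _ x y] lt_irrefl[of x] by blast
qed simp

lemma ex_maximal:
  assumes "Q x0" obtains x where "Q x" "\<And>y. Q y \<Longrightarrow> \<not> x \<prec> y"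
  using ex_has_least_nat[of Q x0 "\<lambda>x. card {z. x \<prec> z}"] assms card_up_less
  by (metis linorder_not_less)

lemma ex_minimal:
  assumes "Q x0" obtains x where "Q x" "\<And>y. Q y \<Longrightarrow> \<not> y \<prec> x"
  using ex_has_least_nat[of Q x0 "\<lambda>x. card {z. z \<prec> x}"] assms card_down_less
  by (metis linorder_not_less)

lemma th_diag: "a \<in> colors P \<Longrightarrow> th a a = 2"
  using dynkin by (auto simp: dynkin_diagram_def)

lemma th_off: "a \<in> colors P \<Longrightarrow> b \<in> colors P \<Longrightarrow> a \<noteq> b \<Longrightarrow> th a b = 0 \<or> th a b = -1"
proof -
  assume ab: "a \<in> colors P" "b \<in> colors P" "a \<noteq> b"
  then have "th a b \<in> {-1, 0, 2}" using laced unfolding simply_laced_def by blast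
  moreover have "th a b \<le> 0" using ab dynkin unfolding dynkin_diagram_def by blast
  ultimately show ?thesis by auto
qed

lemma th_sym: "a \<in> colors P \<Longrightarrow> b \<in> colors P \<Longrightarrow> th a b = th b a"
  using th_off[of a b] th_off[of b a] dynkin unfolding dynkin_diagram_def by metis

lemma adjacent_iff: "a \<in> colors P \<Longrightarrow> b \<in> colors P \<Longrightarrow> adjacent th a b \<longleftrightarrow> th a b = -1"
  using th_off[of a b] th_diag[of a] by (auto simp: adjacent_def)

lemma related_comparable:
  assumes "x \<in> elems P" "y \<in> elems P" "th (col x) (col y) \<noteq> 0" "x \<noteq> y"
  shows "x \<prec> y \<or> y \<prec> x"
proof (cases "col x = col y")
  case True
  then show ?thesis using ec assms unfolding EC_def comparable_def less_in_def by blast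
next
  case False
  then have "th (col x) (col y) = -1"
    using th_off[OF col_in[OF assms(1)] col_in[OF assms(2)]] assms(3) by blast
  then have "adjacent th (col x) (col y)" using False by (simp add: adjacent_def)
  then show ?thesis using ac assms unfolding AC_def comparable_def less_in_def by blast
qed

text \<open>A minimal element among those above \<open>x\<close> and up to \<open>y\<close> covers
  \<open>x\<close>, so NA applies to it. NA mostly enters in this form: an upward path can start
  with a step to an adjacent color.\<close>

lemma adjacent_cover:
  assumes "x \<prec> y"
  obtains z where "covered_by P x z" "z = y \<or> z \<prec> y" "th (col z) (col x) = -1"
proof -
  let ?P = "\<lambda>z. x \<prec> z \<and> (z = y \<or> z \<prec> y)"
  obtain z where z: "?P z" and min: "\<And>w. ?P w \<Longrightarrow> \<not> w \<prec> z"
    using ex_minimal[of ?P y] assms by blast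
  have "\<not> w \<prec> z" if "x \<prec> w" for w
    using min[of w] that z lt_trans[of w z y] by blast
  then have c: "covered_by P x z" using z by (auto simp: covered_by_def open_interval_def)
  then have "adjacent th (col z) (col x)" using na z by (auto simp: NA_def neighbors_def dest: ltD)
  then have "th (col z) (col x) = -1" using z ltD adjacent_iff col_in by metis
  then show thesis using that c z by blast
qed

definition top :: "'c \<Rightarrow> 'a" where
  "top a = (SOME x. x \<in> elems P \<and> col x = a \<and> (\<forall>y\<in>elems P. col y = a \<longrightarrow> \<not> x \<prec> y))"

lemma top_spec:
  assumes "a \<in> colors P"
  shows "top a \<in> elems P \<and> col (top a) = a \<and> (\<forall>y\<in>elems P. col y = a \<longrightarrow> \<not> top a \<prec> y)"
  unfolding top_def
proof (rule someI_ex)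
  let ?P = "\<lambda>x. x \<in> elems P \<and> col x = a"
  obtain x0 where "?P x0" using assms col_image by (metis imageE)
  then obtain x where "?P x" "\<And>y. ?P y \<Longrightarrow> \<not> x \<prec> y"
    using ex_maximal[of ?P x0] by blast
  then show "\<exists>x. x \<in> elems P \<and> col x = a \<and> (\<forall>y\<in>elems P. col y = a \<longrightarrow> \<not> x \<prec> y)"
    by blast
qed

lemma top_in [simp]: "a \<in> colors P \<Longrightarrow> top a \<in> elems P"
  and col_top [simp]: "a \<in> colors P \<Longrightarrow> col (top a) = a"
  using top_spec by auto

lemma below_top:
  assumes "x \<in> elems P" shows "x = top (col x) \<or> x \<prec> top (col x)"
proof -
  have c: "col x \<in> colors P" using assms by simp
  then show ?thesis
    using related_comparable[of x "top (col x)"] top_spec[OF c] assms th_diag[OF c] by auto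
qed

lemma maximal_top: "a \<in> colors P \<Longrightarrow> maximal_in_color P (top a)"
  using top_spec[of a] by (auto simp: maximal_in_color_def)

lemma sum_adjacent:
  assumes "A \<subseteq> elems P" "b \<in> colors P" "\<And>z. z \<in> A \<Longrightarrow> col z \<noteq> b"
  shows "(\<Sum>z\<in>A. th (col z) b) = (\<Sum>z | z \<in> A \<and> adjacent th (col z) b. th (col z) b)"
proof (rule sum.mono_neutral_right)
  show "finite A" using assms(1) fin by (rule finite_subset)
  show "\<forall>z\<in>A - {z \<in> A. adjacent th (col z) b}. th (col z) b = 0"
  proof
    fix z assume z: "z \<in> A - {z \<in> A. adjacent th (col z) b}"
    then have "z \<in> elems P" "col z \<noteq> b" using assms by auto
    then show "th (col z) b = 0" using th_off[of "col z" b] z assms by (auto simp: adjacent_def)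
  qed
qed auto


section \<open>Weights of filters\<close>

text \<open>Normalised so that the weight of \<open>b\<close> is 1 just before \<open>top b\<close>
  is added, which makes sense before a unique maximal element is known. \<open>lam_eq\<close> later
  identifies it as the indicator of the colors without a parent.\<close>

definition lam :: "'c \<Rightarrow> int" where
  "lam b = 1 + (\<Sum>y\<in>upper_adjacent P (top b). th (col y) b)"

definition wt :: "'a set \<Rightarrow> 'c \<Rightarrow> int" where
  "wt F b = lam b - (\<Sum>z\<in>F. th (col z) b)"

definition upset :: "'a set \<Rightarrow> bool" where
  "upset F \<longleftrightarrow> F \<subseteq> elems P \<and> (\<forall>x\<in>F. \<forall>y. x \<prec> y \<longrightarrow> y \<in> F)"

lemma finite_upset: "upset F \<Longrightarrow> finite F"
  using fin finite_subset unfolding upset_def by blast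

lemma upset_lt: "upset {z. x \<prec> z}"
  using lt_trans ltD unfolding upset_def by blast

lemma wt_above_top:
  assumes "b \<in> colors P" shows "wt {z. top b \<prec> z} b = 1"
proof -
  have "(\<Sum>z | top b \<prec> z. th (col z) b) = (\<Sum>z | z \<in> {z. top b \<prec> z} \<and> adjacent th (col z) b. th (col z) b)"
  proof (rule sum_adjacent)
    show "{z. top b \<prec> z} \<subseteq> elems P" by (auto dest: ltD)
    show "col z \<noteq> b" if "z \<in> {z. top b \<prec> z}" for z
      using that top_spec[OF assms] ltD by blast
  qed (rule assms)
  then show ?thesis using assms by (simp add: wt_def lam_def upper_adjacent_def)
qed

text \<open>Going from an element \<open>y\<close> of color \<open>b\<close> to the next lower one
  \<open>x\<close> adds \<open>y\<close>, which counts 2, and the open interval, which counts -2 by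
  ICE2. Any other new element is incomparable to \<open>y\<close>, so its entry with
  \<open>b\<close> is 0. The induction starts at \<open>top b\<close>.\<close>

lemma wt_above:
  assumes "x \<in> elems P" shows "wt {z. x \<prec> z} (col x) = 1"
  using assms
proof (induction "card {z. x \<prec> z}" arbitrary: x rule: less_induct)
  case less
  let ?b = "col x"
  show ?case
  proof (cases "x = top ?b")
    case True
    with less.prems show ?thesis using wt_above_top[of ?b] less.prems by (metis col_in)
  next
    case False
    let ?P = "\<lambda>y. x \<prec> y \<and> col y = ?b"
    have "?P (top ?b)" using False below_top[OF less.prems] less.prems by (metis col_in col_top)
    then obtain y where y: "?P y" and min: "\<And>w. ?P w \<Longrightarrow> \<not> w \<prec> y"
      using ex_minimal[of ?P "top ?b"] by blast
    have nocol: "col w \<noteq> ?b" if "x \<prec> w" "w \<prec> y" for w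
      using min[of w] that by blast
    have yx: "y \<in> elems P" "x \<in> elems P" "x \<prec> y" using y by (auto dest: ltD)
    have "consecutive P ?b x y"
      using y nocol by (auto simp: consecutive_def open_interval_def)
    then have "(\<Sum>z\<in>open_interval P x y. - th (col z) ?b) = 2"
      using ice2 yx by (auto simp: ICE2_def)
    then have s: "(\<Sum>z\<in>open_interval P x y. th (col z) ?b) = -2"
      by (simp add: sum_negf)
    have IH: "wt {z. y \<prec> z} ?b = 1"
      using less.hyps[of y] card_up_less yx y by simp
    let ?A = "{z. y \<prec> z} \<union> {y} \<union> open_interval P x y"
    have "(\<Sum>z | x \<prec> z. th (col z) ?b) = (\<Sum>z\<in>?A. th (col z) ?b)"
    proof (rule sum.mono_neutral_right)
      show "?A \<subseteq> {z. x \<prec> z}" using yx lt_trans[of x y] by (auto simp: open_interval_def)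
      show "\<forall>z\<in>{z. x \<prec> z} - ?A. th (col z) ?b = 0"
      proof
        fix z assume z: "z \<in> {z. x \<prec> z} - ?A"
        then have "\<not> z \<prec> y" "\<not> y \<prec> z" "z \<noteq> y" by (auto simp: open_interval_def)
        then show "th (col z) ?b = 0" using related_comparable[of z y] z y yx by (auto dest: ltD)
      qed
    qed auto
    also have "\<dots> = (\<Sum>z | y \<prec> z. th (col z) ?b) + 2 + (-2)"
    proof -
      have "finite (open_interval P x y)"
        by (rule finite_subset[OF _ fin]) (auto simp: open_interval_def dest: ltD)
      then show ?thesis
        using s th_diag[of ?b] yx y
        by (subst sum.union_disjoint) (auto simp: open_interval_def dest: lt_asym)
    qed
    finally show ?thesis using IH by (simp add: wt_def)
  qed
qed

text \<open>Compare \<open>F\<close> with the filter strictly above \<open>x\<close>. Elements of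
  \<open>F\<close> outside that filter are incomparable to \<open>x\<close> and count 0, so only the
  missing elements above \<open>x\<close> change the value 1 of \<open>wt_above\<close>, and none of
  them has the color of \<open>x\<close>. Hence each can only lower the weight.\<close>

lemma wt_highest_missing:
  assumes F: "upset F" and x: "x \<in> elems P" "x \<notin> F"
    and high: "\<And>y. x \<prec> y \<Longrightarrow> col y = col x \<Longrightarrow> y \<in> F"
  shows "wt F (col x) = 1 + (\<Sum>z\<in>{z. x \<prec> z} - F. th (col z) (col x))"
    and "\<And>z. z \<in> {z. x \<prec> z} - F \<Longrightarrow> th (col z) (col x) = 0 \<or> th (col z) (col x) = -1"
proof -
  let ?b = "col x" and ?U = "{z. x \<prec> z}"
  have fF: "finite F" using finite_upset[OF F] .
  have "(\<Sum>z\<in>F. th (col z) ?b) = (\<Sum>z\<in>F \<inter> ?U. th (col z) ?b)"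
  proof (rule sum.mono_neutral_right[OF fF])
    have "th (col z) ?b = 0" if z: "z \<in> F" "\<not> x \<prec> z" for z
    proof (rule ccontr)
      have zP: "z \<in> elems P" using z F by (auto simp: upset_def)
      assume "th (col z) ?b \<noteq> 0"
      then have "z \<prec> x" using related_comparable[of z x] z zP x by auto
      then show False using F z x by (auto simp: upset_def)
    qed
    then show "\<forall>z\<in>F - F \<inter> ?U. th (col z) ?b = 0" by blast
  qed auto
  moreover have "(\<Sum>z\<in>?U. th (col z) ?b) = (\<Sum>z\<in>F \<inter> ?U. th (col z) ?b) + (\<Sum>z\<in>?U - F. th (col z) ?b)"
    by (subst sum.union_disjoint[symmetric]) (auto intro!: sum.cong)
  ultimately show "wt F ?b = 1 + (\<Sum>z\<in>?U - F. th (col z) ?b)"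
    using wt_above[OF x(1)] by (simp add: wt_def)
  fix z assume z: "z \<in> ?U - F"
  then have "col z \<noteq> ?b" using high by auto
  then show "th (col z) ?b = 0 \<or> th (col z) ?b = -1"
    using th_off[of "col z" ?b] z x by (auto dest: ltD)
qed

lemma highest_missing:
  assumes "x0 \<in> elems P" "x0 \<notin> F"
  obtains x where "x \<in> elems P" "x \<notin> F" "col x = col x0"
    "\<And>y. x \<prec> y \<Longrightarrow> col y = col x0 \<Longrightarrow> y \<in> F"
proof -
  let ?P = "\<lambda>x. x \<in> elems P \<and> x \<notin> F \<and> col x = col x0"
  obtain x where x: "?P x" and max: "\<And>y. ?P y \<Longrightarrow> \<not> x \<prec> y"
    using ex_maximal[of ?P x0] assms by blast
  have "y \<in> F" if "x \<prec> y" and "col y = col x0" for y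
    using max[of y] that by (auto dest: ltD)
  then show thesis using that x by blast
qed

text \<open>Let \<open>y\<close> be the lowest element of color \<open>b\<close>. The weight is 1
  above \<open>y\<close>, then \<open>y\<close> takes off 2, and by LCB1 the elements below
  \<open>y\<close> give back at most 1.\<close>

lemma wt_exhausted:
  assumes F: "upset F" and b: "b \<in> colors P" and all: "\<And>x. x \<in> elems P \<Longrightarrow> col x = b \<Longrightarrow> x \<in> F"
  shows "wt F b \<le> 0"
proof -
  let ?P = "\<lambda>x. x \<in> elems P \<and> col x = b"
  have "?P (top b)" using b by simp
  then obtain y where y: "?P y" and low: "\<And>w. ?P w \<Longrightarrow> \<not> w \<prec> y"
    using ex_minimal[of ?P "top b"] by blast
  have fF: "finite F" and FP: "F \<subseteq> elems P" using finite_upset[OF F] F by (simp_all add: upset_def)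
  have "minimal_in_color P y" using y low by (auto simp: minimal_in_color_def)
  then have l: "(\<Sum>z\<in>lower_adjacent P y. - th (col z) b) \<le> 1"
    using lcb1 y by (auto simp: LCB1_def)
  let ?D = "{z \<in> F. z \<prec> y}" and ?A = "{z. y \<prec> z}"
  have "(\<Sum>z\<in>F. th (col z) b) = (\<Sum>z\<in>?A \<union> {y} \<union> ?D. th (col z) b)"
  proof (rule sum.mono_neutral_right[OF fF])
    show "?A \<union> {y} \<union> ?D \<subseteq> F" using F all y by (auto simp: upset_def)
    show "\<forall>z\<in>F - (?A \<union> {y} \<union> ?D). th (col z) b = 0"
    proof
      fix z assume z: "z \<in> F - (?A \<union> {y} \<union> ?D)"
      then show "th (col z) b = 0" using related_comparable[of z y] y FP by auto
    qed
  qed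
  also have "\<dots> = (\<Sum>z\<in>?A. th (col z) b) + 2 + (\<Sum>z\<in>?D. th (col z) b)"
    using fF y th_diag[OF b] by (subst sum.union_disjoint) (auto dest: lt_asym)
  finally have "wt F b = -1 - (\<Sum>z\<in>?D. th (col z) b)"
    using wt_above[of y] y by (simp add: wt_def)
  moreover have "(\<Sum>z\<in>?D. th (col z) b) \<ge> -1"
  proof -
    have "(\<Sum>z\<in>?D. th (col z) b) = (\<Sum>z | z \<in> ?D \<and> adjacent th (col z) b. th (col z) b)"
      using low b FP by (intro sum_adjacent[of ?D b]) auto
    moreover have "(\<Sum>z | z \<in> ?D \<and> adjacent th (col z) b. - th (col z) b)
        \<le> (\<Sum>z\<in>lower_adjacent P y. - th (col z) b)"
    proof (rule sum_mono2)
      show "finite (lower_adjacent P y)"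
        by (rule finite_subset[OF _ fin]) (auto simp: lower_adjacent_def dest: ltD)
    qed (use y in \<open>auto simp: lower_adjacent_def adjacent_def\<close>)
    ultimately show ?thesis using l by (simp add: sum_negf)
  qed
  ultimately show ?thesis by simp
qed

lemma wt_le_1:
  assumes F: "upset F" and b: "b \<in> colors P"
  shows "wt F b \<le> 1"
proof (cases "\<exists>x\<in>elems P. x \<notin> F \<and> col x = b")
  case True
  then obtain x0 where "x0 \<in> elems P" "x0 \<notin> F" "col x0 = b" by auto
  then obtain x where x: "x \<in> elems P" "x \<notin> F" "col x = b" "\<And>y. x \<prec> y \<Longrightarrow> col y = b \<Longrightarrow> y \<in> F"
    using highest_missing by metis
  note w = wt_highest_missing[OF F x(1,2)]
  have "(\<Sum>z\<in>{z. x \<prec> z} - F. th (col z) (col x)) \<le> 0"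
    using w(2) x(3,4) by (intro sum_nonpos) fastforce
  then show ?thesis using w(1) x(3,4) by simp
next
  case False
  then show ?thesis using wt_exhausted[OF F b] by fastforce
qed

lemma wt_addable:
  assumes F: "upset F" and x: "x \<in> elems P" "x \<notin> F" and up: "\<And>y. x \<prec> y \<Longrightarrow> y \<in> F"
  shows "wt F (col x) = 1"
proof -
  have "{z. x \<prec> z} - F = {}" using up by auto
  then show ?thesis using wt_highest_missing(1)[OF F x] up by (metis add.right_neutral sum.empty)
qed

text \<open>Weight 1 leaves no room for a missing element of adjacent color above the highest
  missing \<open>x\<close>. A missing \<open>y\<close> above \<open>x\<close> would force one: the
  first step from \<open>x\<close> towards \<open>y\<close> has adjacent color, and if it were in
  the filter then so would be \<open>y\<close>.\<close>

lemma wt_1_extend: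
  assumes F: "upset F" and b: "b \<in> colors P" and one: "wt F b = 1"
  obtains x where "x \<in> elems P" "x \<notin> F" "col x = b" "upset (insert x F)"
    "\<And>c. wt (insert x F) c = wt F c - th b c"
proof -
  obtain x0 where x0: "x0 \<in> elems P" "x0 \<notin> F" "col x0 = b"
    using wt_exhausted[OF F b] one by force
  then obtain x where x: "x \<in> elems P" "x \<notin> F" "col x = b" "\<And>y. x \<prec> y \<Longrightarrow> col y = b \<Longrightarrow> y \<in> F"
    using highest_missing by metis
  note w = wt_highest_missing[OF F x(1,2)]
  let ?D = "{z. x \<prec> z} - F"
  have s: "(\<Sum>z\<in>?D. - th (col z) b) = 0" using one w(1) x(3,4) by (simp add: sum_negf)
  have nn: "\<And>z. z \<in> ?D \<Longrightarrow> - th (col z) b \<ge> 0" using w(2) x(3,4) by fastforce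
  have fD: "finite ?D" by simp
  have D0: "th (col z) b = 0" if "z \<in> ?D" for z
  proof -
    have "\<forall>z\<in>?D. - th (col z) b = 0"
      using s by (subst (asm) sum_nonneg_eq_0_iff) (use nn in auto)
    then show ?thesis using that by auto
  qed
  have "y \<in> F" if xy: "x \<prec> y" for y
  proof -
    obtain z where z: "covered_by P x z" "z = y \<or> z \<prec> y" "th (col z) (col x) = -1"
      using adjacent_cover[OF xy] .
    have "z \<in> F" using D0[of z] z x(3) by (auto simp: covered_by_def)
    then show ?thesis using F z(2) by (auto simp: upset_def)
  qed
  then have "upset (insert x F)" using F x by (auto simp: upset_def)
  moreover have "wt (insert x F) c = wt F c - th b c" for c
    using x finite_upset[OF F] by (simp add: wt_def)
  ultimately show thesis using that x by blast
qed

text \<open>A maximal missing element would be addable, giving its color weight 1.\<close>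

lemma upset_all:
  assumes F: "upset F" and le0: "\<And>b. b \<in> colors P \<Longrightarrow> wt F b \<le> 0"
  shows "F = elems P"
proof (rule ccontr)
  assume "F \<noteq> elems P"
  then obtain x0 where "x0 \<in> elems P" "x0 \<notin> F" using F by (auto simp: upset_def)
  let ?P = "\<lambda>x. x \<in> elems P \<and> x \<notin> F"
  obtain x where x: "?P x" and max: "\<And>y. ?P y \<Longrightarrow> \<not> x \<prec> y"
    using ex_maximal[of ?P x0] \<open>x0 \<in> _\<close> \<open>x0 \<notin> F\<close> by blast
  have "y \<in> F" if "x \<prec> y" for y
    using max[of y] that by (auto dest: ltD)
  then have "wt F (col x) = 1" using wt_addable[OF F] x by auto
  then show False using le0[of "col x"] x by simp
qed

end


section \<open>The top tree\<close>

context minuscule_game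
begin

text \<open>In the simply laced case every summand of UCB1 is 1, so the axiom bounds a
  cardinality.\<close>

lemma upper_adjacent_card:
  assumes "b \<in> colors P"
  shows "(\<Sum>y\<in>upper_adjacent P (top b). th (col y) b) = - int (card (upper_adjacent P (top b)))"
    and "card (upper_adjacent P (top b)) \<le> 1" and "finite (upper_adjacent P (top b))"
proof -
  let ?U = "upper_adjacent P (top b)"
  show fin: "finite ?U" using ucb1 maximal_top[OF assms] by (auto simp: UCB1_def)
  have "th (col y) b = -1" if "y \<in> ?U" for y
    using that assms adjacent_iff[of "col y" b] by (auto simp: upper_adjacent_def dest: ltD)
  then show s: "(\<Sum>y\<in>?U. th (col y) b) = - int (card ?U)" by simp
  have "(\<Sum>y\<in>?U. - th (col y) b) \<le> 1"
    using ucb1 maximal_top[OF assms] assms by (auto simp: UCB1_def)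
  then show "card ?U \<le> 1" using s by (simp add: sum_negf)
qed

text \<open>The top tree is handled on colors, with the parent as first argument.\<close>

definition child :: "'c \<Rightarrow> 'c \<Rightarrow> bool" where
  "child a b \<longleftrightarrow> a \<in> colors P \<and> b \<in> colors P \<and> th a b = -1 \<and> top b \<prec> top a"

lemma childD: "child a b \<Longrightarrow> a \<in> colors P" "child a b \<Longrightarrow> b \<in> colors P"
  "child a b \<Longrightarrow> th a b = -1" "child a b \<Longrightarrow> top b \<prec> top a"
  by (simp_all add: child_def)

text \<open>UCB1 admits only one element of adjacent color above \<open>top b\<close>. The highest
  element of that same color also lies above \<open>top b\<close>, so the two coincide; parents are
  unique for the same reason.\<close>

lemma above_top_adjacent:
  assumes b: "b \<in> colors P" and y: "top b \<prec> y" "th (col y) b = -1"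
  shows "y = top (col y)" and "child (col y) b"
    and "\<And>z. top b \<prec> z \<Longrightarrow> th (col z) b = -1 \<Longrightarrow> z = y"
proof -
  have mem: "w \<in> upper_adjacent P (top b)" if "top b \<prec> w" "th (col w) b = -1" for w
    using that b adjacent_iff[of "col w" b] by (auto simp: upper_adjacent_def dest: ltD)
  show uniq: "z = y" if "top b \<prec> z" "th (col z) b = -1" for z
    using mem[OF that] mem[OF y] upper_adjacent_card(2,3)[OF b] card_le_Suc0_iff_eq by fastforce
  have yP: "y \<in> elems P" using y by (auto dest: ltD)
  show t: "y = top (col y)"
    using below_top[OF yP] uniq[of "top (col y)"] y lt_trans[of "top b" y] yP
    by (metis col_in col_top)
  then show "child (col y) b" using b y yP by (simp add: child_def)
qed

lemma child_unique: "child a b \<Longrightarrow> child a' b \<Longrightarrow> a = a'"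
  using above_top_adjacent(3)[of b "top a" "top a'"] unfolding child_def by (metis col_top)

lemma adjacent_child:
  assumes "a \<in> colors P" "b \<in> colors P" "th a b = -1"
  shows "child a b \<or> child b a"
proof -
  have "a \<noteq> b" using th_diag assms by force
  then have "top a \<noteq> top b" using assms col_top by metis
  then show ?thesis
    using related_comparable[of "top a" "top b"] assms th_sym[of a b] by (auto simp: child_def)
qed

lemma child_cover:
  assumes "b \<in> colors P" "top b \<prec> y"
  obtains a where "child a b" "y = top a \<or> top a \<prec> y" "covered_by P (top b) (top a)"
proof -
  obtain z where z: "covered_by P (top b) z" "z = y \<or> z \<prec> y" "th (col z) b = -1"
    using adjacent_cover[OF assms(2)] assms(1) col_top by metis
  then have "top b \<prec> z" by (simp add: covered_by_def)
  then show thesis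
    using that[of "col z"] above_top_adjacent[OF assms(1) _ z(3)] z by (metis)
qed

lemma lam_eq:
  assumes "b \<in> colors P" shows "lam b = (if \<exists>a. child a b then 0 else 1)"
proof (cases "\<exists>a. child a b")
  case True
  then obtain a where "child a b" by auto
  then have "top a \<in> upper_adjacent P (top b)"
    using adjacent_iff[of a b] by (simp add: upper_adjacent_def child_def)
  then have "card (upper_adjacent P (top b)) = 1"
    using upper_adjacent_card(2,3)[OF assms] by (metis One_nat_def Suc_leI card_gt_0_iff empty_iff le_antisym)
  then show ?thesis using True upper_adjacent_card(1)[OF assms] by (simp add: lam_def)
next
  case False
  have "upper_adjacent P (top b) = {}"
  proof (rule equals0I)
    fix y assume "y \<in> upper_adjacent P (top b)"
    then have "top b \<prec> y" by (simp add: upper_adjacent_def)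
    then show False using child_cover[OF assms] False by metis
  qed
  then show ?thesis using False by (simp add: lam_def)
qed

definition root :: "'c \<Rightarrow> bool" where
  "root r \<longleftrightarrow> r \<in> colors P \<and> (\<forall>a. \<not> child a r)"

definition root_above :: "'c \<Rightarrow> 'c \<Rightarrow> bool" where
  "root_above r b \<longleftrightarrow> root r \<and> (b = r \<or> top b \<prec> top r)"

lemma root_not_below: "root r \<Longrightarrow> \<not> top r \<prec> y"
  using child_cover[of r y] unfolding root_def by metis

lemma root_above_child:
  assumes "child a b" shows "root_above r b \<longleftrightarrow> root_above r a"
proof
  assume r: "root_above r b"
  then have "b \<noteq> r" using assms by (auto simp: root_above_def root_def)
  then have "top b \<prec> top r" using r by (simp add: root_above_def)
  then obtain a' where "child a' b" "top r = top a' \<or> top a' \<prec> top r"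
    using child_cover[OF childD(2)[OF assms]] by metis
  moreover have "a' = a" using child_unique[OF \<open>child a' b\<close> assms] .
  ultimately show "root_above r a"
    using r childD(1)[OF assms] unfolding root_above_def root_def by (metis col_top)
next
  assume "root_above r a"
  then show "root_above r b"
    using childD(4)[OF assms] lt_trans[of "top b" "top a"] by (auto simp: root_above_def)
qed

lemma ex_root_above:
  assumes "b \<in> colors P" obtains r where "root_above r b"
proof -
  let ?Q = "\<lambda>x. x = top b \<or> top b \<prec> x"
  obtain x where x: "?Q x" "\<And>y. ?Q y \<Longrightarrow> \<not> x \<prec> y"
    using ex_maximal[of ?Q "top b"] by blast
  then have xP: "x \<in> elems P" using assms by (auto dest: ltD)
  have no: "\<not> x \<prec> y" for y using x lt_trans[of "top b" x y] by blast
  then have t: "x = top (col x)" using below_top[OF xP] by blast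
  then have "root (col x)" using no childD(4) col_in[OF xP] unfolding root_def by metis
  then have "root_above (col x) b"
    using x t assms unfolding root_above_def by (metis col_top)
  then show thesis using that by blast
qed

text \<open>Neighbors have parent and child as colors, and \<open>root_above s\<close> is the same
  on both ends of such an edge. Connectedness makes it constant, while nothing lies above the top of
  a root.\<close>

lemma root_unique:
  assumes "root r" "root r'" shows "r = r'"
proof -
  have nb: "root_above s (col x) = root_above s (col y)" if "neighbors P x y" for x y s
  proof -
    have xy: "x \<in> elems P" "y \<in> elems P"
      using that ltD unfolding neighbors_def covered_by_def by blast+
    then have "th (col x) (col y) = -1"
      using that na adjacent_iff by (auto simp: NA_def)
    then show ?thesis
      using adjacent_child[of "col x" "col y"] root_above_child xy by auto
  qed
  have "root_above s (col x) = root_above s (col y)"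
    if "(x, y) \<in> {(u, v). neighbors P u v}\<^sup>*" for x y s
    using that by (induction rule: rtrancl_induct) (use nb in auto)
  moreover have "(top r, top r') \<in> {(u, v). neighbors P u v}\<^sup>*"
    using conn assms unfolding connected_poset_def root_def by simp
  ultimately have "root_above r' r = root_above r' r'"
    using assms unfolding root_def by (metis col_top)
  then show ?thesis using assms root_not_below by (auto simp: root_above_def)
qed

text \<open>The only element above \<open>top b\<close> whose color is adjacent to \<open>b\<close>
  is the top of its parent, and this lies at or below \<open>top v\<close>, outside the filter.
  Together with \<open>wt_above_top\<close> this is the starting position 1, 0, ..., 0 of the game
  on a subtree.\<close>

lemma wt_above_descendant:
  assumes v: "v \<in> colors P" and b: "b \<in> colors P" and bv: "top b \<prec> top v"
  shows "wt {z. top v \<prec> z} b = 0"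
proof -
  obtain a where a: "child a b" "top v = top a \<or> top a \<prec> top v"
    using child_cover[OF b bv] by metis
  have "th (col z) b = 0" if z: "top v \<prec> z" for z
  proof (rule ccontr)
    assume nz: "th (col z) b \<noteq> 0"
    have bz: "top b \<prec> z" using bv z lt_trans by blast
    have zP: "z \<in> elems P" using z by (auto dest: ltD)
    have "col z \<noteq> b" using bz top_spec[OF b] zP by blast
    then have m: "th (col z) b = -1" using th_off[OF _ b, of "col z"] nz zP by auto
    have "z = top (col z)" "col z = a"
      using above_top_adjacent[OF b bz m] child_unique a by blast+
    then show False using a z lt_trans[of "top v" z] by (metis lt_irrefl)
  qed
  then show ?thesis using a lam_eq[OF b] by (auto simp: wt_def)
qed

text \<open>Each color occurs once, so the sum is 2 minus the number of children minus the number of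
  parents. The number of parents also sits in \<open>lam b\<close> and cancels, so roots need no
  separate formula.\<close>

lemma wt_tops:
  assumes b: "b \<in> colors P"
  shows "wt (top ` colors P) b = int (card {a. child b a}) - 1"
proof -
  have inj: "inj_on top (colors P)" by (metis inj_onI col_top)
  let ?C = "{a. child b a}" and ?Q = "{a. child a b}"
  have sub: "?C \<subseteq> colors P" "?Q \<subseteq> colors P" by (auto dest: childD)
  have f: "finite ?C" "finite ?Q" using sub by (auto intro: finite_subset[OF _ finite_colors])
  have disj: "?C \<inter> ?Q = {}" "b \<notin> ?C" "b \<notin> ?Q" using lt_asym by (auto simp: child_def)
  have "(\<Sum>z\<in>top ` colors P. th (col z) b) = (\<Sum>a\<in>colors P. th a b)"
    by (simp add: sum.reindex[OF inj])
  also have "\<dots> = (\<Sum>a\<in>?C \<union> ?Q \<union> {b}. th a b)"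
  proof (rule sum.mono_neutral_right)
    show "\<forall>a\<in>colors P - (?C \<union> ?Q \<union> {b}). th a b = 0"
      using th_off[OF _ b] adjacent_child[OF _ b] by blast
  qed (use sub b in auto)
  also have "\<dots> = (\<Sum>a\<in>?C. th a b) + (\<Sum>a\<in>?Q. th a b) + th b b"
    using f disj by (subst sum.union_disjoint, auto)+
  also have "(\<Sum>a\<in>?C. th a b) = - int (card ?C)"
    using th_sym[OF _ b] childD by (subst sum.cong[OF refl, of _ _ "\<lambda>_. -1"]) auto
  also have "(\<Sum>a\<in>?Q. th a b) = - int (card ?Q)"
    using childD by (subst sum.cong[OF refl, of _ _ "\<lambda>_. -1"]) auto
  finally have s: "(\<Sum>z\<in>top ` colors P. th (col z) b) = 2 - int (card ?C) - int (card ?Q)"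
    using th_diag[OF b] by simp
  have "lam b = 1 - int (card ?Q)"
  proof (cases "\<exists>a. child a b")
    case True
    then obtain a where "child a b" by auto
    then have "?Q = {a}" using child_unique by auto
    then show ?thesis using True lam_eq[OF b] by auto
  next
    case False
    then have "?Q = {}" by auto
    then show ?thesis using False lam_eq[OF b] by (metis card.empty diff_zero of_nat_0)
  qed
  then show ?thesis using s by (simp add: wt_def)
qed

lemma upset_tops: "upset (top ` colors P)"
proof -
  have "y \<in> top ` colors P" if "b \<in> colors P" "top b \<prec> y" for b y
    using that
  proof (induction "card {z. top b \<prec> z}" arbitrary: b rule: less_induct)
    case less
    obtain a where a: "child a b" "y = top a \<or> top a \<prec> y"
      using child_cover[OF less.prems] by metis
    then show ?case
      using less.hyps[of a] card_up_less childD(1,4)[OF a(1)] by auto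
  qed
  then show ?thesis by (auto simp: upset_def)
qed

end

section \<open>Playing on embedded trees\<close>

text \<open>A rooted tree on the nodes 0, 1, ... with root 0 is given by its parent function.\<close>

definition tree_theta :: "(nat \<Rightarrow> nat) \<Rightarrow> nat \<Rightarrow> nat \<Rightarrow> int" where
  "tree_theta par i j =
     (if i = j then 2 else if (0 < j \<and> par j = i) \<or> (0 < i \<and> par i = j) then -1 else 0)"

text \<open>The empty list stands for an illegal move, so an entry above 1 in the result also
  certifies that all moves were legal.\<close>

fun play :: "(nat \<Rightarrow> nat) \<Rightarrow> nat list \<Rightarrow> int list \<Rightarrow> int list" where
  "play par [] l = l"
| "play par (i # w) l =
     (if i < length l \<and> l ! i = 1
      then play par w (map (\<lambda>j. l ! j - tree_theta par i j) [0..<length l]) else [])"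

context minuscule_game
begin

text \<open>Node \<open>e 0\<close> may be any color, not only the root of the diagram, and children
  may be left out. Distinctness is asked of siblings only, which is easy to check; injectivity
  follows.\<close>

definition embedded_tree :: "(nat \<Rightarrow> 'c) \<Rightarrow> (nat \<Rightarrow> nat) \<Rightarrow> nat \<Rightarrow> bool" where
  "embedded_tree e par N \<longleftrightarrow> 0 < N \<and> e 0 \<in> colors P \<and>
     (\<forall>i. 0 < i \<and> i < N \<longrightarrow> par i < i \<and> child (e (par i)) (e i)) \<and>
     (\<forall>i j. 0 < i \<and> i < j \<and> j < N \<and> par i = par j \<longrightarrow> e i \<noteq> e j)"

context
  fixes e par N
  assumes emb: "embedded_tree e par N"
begin

lemma embedded_child: "0 < i \<Longrightarrow> i < N \<Longrightarrow> par i < i \<and> child (e (par i)) (e i)"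
  using emb by (auto simp: embedded_tree_def)

lemma embedded_in: "i < N \<Longrightarrow> e i \<in> colors P"
  using emb embedded_child[of i] childD(2) by (cases "i = 0") (auto simp: embedded_tree_def)

lemma embedded_below_root: "0 < i \<Longrightarrow> i < N \<Longrightarrow> top (e i) \<prec> top (e 0)"
proof (induction i rule: less_induct)
  case (less i)
  have c: "par i < i" "top (e i) \<prec> top (e (par i))"
    using embedded_child[OF less.prems] childD(4) by auto
  then show ?case using less.IH[of "par i"] less.prems lt_trans by (cases "par i = 0") auto
qed

text \<open>Induction on the larger index: nodes of equal color have parents of equal color by
  \<open>child_unique\<close>, hence equal parent indices, and then they are siblings.\<close>

lemma embedded_inj: "inj_on e {..<N}"
proof -
  have "e i \<noteq> e j" if "i < j" "j < N" for i j
    using that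
  proof (induction j arbitrary: i rule: less_induct)
    case (less j)
    show ?case
    proof
      assume eq: "e i = e j"
      have "0 < i" using eq embedded_below_root[of j] less.prems lt_irrefl by (cases i) auto
      then have ci: "par i < i" "child (e (par i)) (e i)"
        and cj: "par j < j" "child (e (par j)) (e j)"
        using embedded_child[of i] embedded_child[of j] less.prems by auto
      then have pe: "e (par i) = e (par j)" using child_unique eq by metis
      have "par i = par j"
      proof (rule ccontr)
        assume "par i \<noteq> par j"
        then consider "par i < par j" | "par j < par i" by linarith
        then show False
        proof cases
          case 1
          then show False using less.IH[of "par j" "par i"] pe cj less.prems by simp
        next
          case 2
          then show False using less.IH[of "par i" "par j"] pe ci less.prems by simp
        qed
      qed
      then show False using emb \<open>0 < i\<close> less.prems eq by (auto simp: embedded_tree_def)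
    qed
  qed
  then show ?thesis by (metis inj_onI lessThan_iff nat_neq_iff)
qed

lemma embedded_child_iff:
  assumes "i < N" "j < N"
  shows "child (e i) (e j) \<longleftrightarrow> 0 < j \<and> par j = i"
proof
  assume c: "child (e i) (e j)"
  have "j \<noteq> 0"
  proof
    assume "j = 0"
    then have "top (e 0) \<prec> top (e i)" using c childD(4) by auto
    then show False using embedded_below_root[of i] assms lt_asym lt_irrefl by (cases "i = 0") auto
  qed
  then have "par j < j" "child (e (par j)) (e j)" using embedded_child[of j] assms by auto
  then have "e (par j) = e i" using c child_unique by blast
  then show "0 < j \<and> par j = i"
    using \<open>j \<noteq> 0\<close> \<open>par j < j\<close> assms embedded_inj by (auto dest: inj_onD)
qed (use embedded_child assms in auto)

text \<open>Adjacent colors are always parent and child, so the image of the tree is an induced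
  subdiagram without extra edges.\<close>

lemma embedded_theta:
  assumes "i < N" "j < N" shows "th (e i) (e j) = tree_theta par i j"
proof -
  have c: "e i \<in> colors P" "e j \<in> colors P" using assms embedded_in by auto
  consider "i = j" | "i \<noteq> j" "child (e i) (e j) \<or> child (e j) (e i)"
    | "i \<noteq> j" "\<not> child (e i) (e j)" "\<not> child (e j) (e i)" by blast
  then show ?thesis
  proof cases
    case 1
    then show ?thesis using th_diag c by (simp add: tree_theta_def)
  next
    case 2
    then show ?thesis
      using embedded_child_iff assms childD(3) th_sym[OF c] by (auto simp: tree_theta_def)
  next
    case 3
    then have "e i \<noteq> e j" using embedded_inj assms by (auto dest: inj_onD)
    then have "th (e i) (e j) = 0" using th_off[OF c] adjacent_child[OF c] 3 by blast
    then show ?thesis using 3 embedded_child_iff assms by (auto simp: tree_theta_def)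
  qed
qed

text \<open>Weights outside the tree are left open. Moves at tree nodes alter them, but whether such
  a move is legal depends on the tree weights alone.\<close>

definition reach :: "(nat \<Rightarrow> int) \<Rightarrow> bool" where
  "reach \<mu> \<longleftrightarrow> (\<exists>F. upset F \<and> (\<forall>i<N. wt F (e i) = \<mu> i))"

lemma reach_start: "reach (\<lambda>i. if i = 0 then 1 else 0)"
  unfolding reach_def
proof (intro exI conjI allI impI)
  show "upset {z. top (e 0) \<prec> z}" by (rule upset_lt)
  fix i assume i: "i < N"
  show "wt {z. top (e 0) \<prec> z} (e i) = (if i = 0 then 1 else 0)"
    using wt_above_top[of "e 0"] wt_above_descendant[of "e 0" "e i"] embedded_in embedded_below_root i
    by (cases "i = 0") auto
qed

lemma reach_le: "reach \<mu> \<Longrightarrow> i < N \<Longrightarrow> \<mu> i \<le> 1"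
  using wt_le_1 embedded_in by (auto simp: reach_def) metis

lemma reach_step:
  assumes "reach \<mu>" "i < N" "\<mu> i = 1" "\<And>j. j < N \<Longrightarrow> \<nu> j = \<mu> j - tree_theta par i j"
  shows "reach \<nu>"
proof -
  obtain F where F: "upset F" "\<And>j. j < N \<Longrightarrow> wt F (e j) = \<mu> j"
    using assms by (auto simp: reach_def)
  obtain x where "upset (insert x F)" "\<And>c. wt (insert x F) c = wt F c - th (e i) c"
    using wt_1_extend[OF F(1) embedded_in[OF assms(2)]] F(2) assms by metis
  then show ?thesis using F(2) assms embedded_theta by (auto simp: reach_def)
qed

lemma reach_play:
  assumes "reach ((!) l)" "length l = N" "play par w l \<noteq> []"
  shows "reach ((!) (play par w l)) \<and> length (play par w l) = N"
  using assms
proof (induction w arbitrary: l)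
  case (Cons i w)
  let ?l = "map (\<lambda>j. l ! j - tree_theta par i j) [0..<length l]"
  have i: "i < N" "l ! i = 1" using Cons.prems by (auto split: if_splits)
  have "reach ((!) ?l)" by (rule reach_step[OF Cons.prems(1) i]) (use Cons.prems in auto)
  then show ?case using Cons.IH[of ?l] Cons.prems i by auto
qed auto

lemma play_no_overflow:
  assumes "\<exists>k\<in>set (play par w (1 # replicate (N - 1) 0)). 1 < k"
  shows False
proof -
  let ?l = "1 # replicate (N - 1) 0 :: int list"
  have N: "0 < N" using emb by (simp add: embedded_tree_def)
  have ne: "play par w ?l \<noteq> []" using assms by auto
  have "reach ((!) ?l)"
  proof -
    obtain F where "upset F" "\<And>i. i < N \<Longrightarrow> wt F (e i) = (if i = 0 then 1 else 0)"
      using reach_start by (auto simp: reach_def)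
    then show ?thesis by (auto simp: reach_def nth_Cons split: nat.splits intro!: exI[of _ F])
  qed
  then have "reach ((!) (play par w ?l))" "length (play par w ?l) = N"
    using reach_play[of ?l w] ne N by auto
  then show False using assms reach_le by (metis in_set_conv_nth not_le)
qed

end

end


section \<open>The shape of the top tree\<close>

text \<open>A stem 0, ..., s with two branches s+1, ..., s+p and s+p+1, s+p+2, ... at its lower end.\<close>

definition shape_par :: "nat \<Rightarrow> nat \<Rightarrow> nat \<Rightarrow> nat" where
  "shape_par s p i = (if i = s + p + 1 then s else i - 1)"

context minuscule_game
begin

section \<open>Branchings that overflow\<close>

lemma embedded_tree_code:
  "embedded_tree e par N \<longleftrightarrow> 0 < N \<and> e 0 \<in> colors P \<and>
     list_all (\<lambda>i. par i < i \<and> child (e (par i)) (e i) \<and>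
       list_all (\<lambda>j. par i = par j \<longrightarrow> e i \<noteq> e j) [Suc i..<N]) [1..<N]"
  unfolding embedded_tree_def list_all_iff by (auto simp: Suc_le_eq)

text \<open>This is D4 rooted at its center: playing the root and then its three children raises the
  root from -1 to 2.\<close>

lemma at_most_two_children:
  assumes "child v a" "child v b" "child v c"
  shows "a = b \<or> a = c \<or> b = c"
proof (rule ccontr)
  assume d: "\<not> ?thesis"
  have "embedded_tree ((!) [v, a, b, c]) ((!) [0, 0, 0, 0]) 4"
    using assms d childD(1)[OF assms(1)] by (simp add: embedded_tree_code upt_rec)
  moreover have "\<exists>k\<in>set (play ((!) [0, 0, 0, 0]) [0, 1, 2, 3] (1 # replicate (4 - 1) 0)). 1 < k"
    by code_simp
  ultimately show False by (rule play_no_overflow)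
qed

text \<open>The tree is D_n rooted at its adjoint node \<open>v\<close>, with \<open>d\<close> as
  the near end and \<open>b\<close>, \<open>b'\<close> as the fork. Play goes down the chain,
  through both ends of the fork and back up, while \<open>d\<close> keeps its weight 1 for a last
  move that lifts \<open>v\<close> to 2. The chain has arbitrary length, so the moves are made by
  induction instead of evaluation.\<close>

lemma no_nested_branching:
  assumes v: "child v w" "child v d" "w \<noteq> d"
    and f: "f 0 = w" "\<And>i. i < k \<Longrightarrow> child (f i) (f (Suc i))"
    and c: "child (f k) b" "child (f k) b'" "b \<noteq> b'"
  shows False
proof -
  define K where "K = Suc k"
  define par where "par = (\<lambda>i. if i = K + 1 then 0 else if i = K + 2 \<or> i = K + 3 then K else i - 1)"
  define e where "e = (\<lambda>i. if i = 0 then v else if i \<le> K then f (i - 1)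
    else if i = K + 1 then d else if i = K + 2 then b else b')"
  define N where "N = K + 4"
  have K: "1 \<le> K" by (simp add: K_def)
  have emb: "embedded_tree e par N"
    unfolding embedded_tree_def
  proof (intro conjI allI impI)
    fix i assume i: "0 < i \<and> i < N"
    then have "i = 1 \<or> (\<exists>j<k. i = Suc (Suc j)) \<or> i = K + 1 \<or> i = K + 2 \<or> i = K + 3"
      unfolding N_def K_def by presburger
    then show "child (e (par i)) (e i)"
      by (elim disjE exE conjE) (use v f c in \<open>auto simp: par_def e_def K_def\<close>)
    show "par i < i" using i by (auto simp: par_def)
  next
    fix i j assume ij: "0 < i \<and> i < j \<and> j < N \<and> par i = par j"
    then have "i = 1 \<and> j = K + 1 \<or> i = K + 2 \<and> j = K + 3"
      using K by (auto simp: par_def N_def split: if_splits)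
    then show "e i \<noteq> e j"
      using v f c K by (auto simp: e_def)
  qed (use v childD(1) in \<open>auto simp: N_def e_def\<close>)
  note step = reach_step[OF emb]
  let ?d = "\<lambda>i j. if i = j then 1 else 0 :: int"
  let ?R = "reach e N"
  \<comment> \<open>The position after playing nodes 0 to \<open>m\<close>; index
    \<open>K + 1\<close> is the waiting node \<open>d\<close>.\<close>
  have up: "?R (\<lambda>j. ?d (K + 1) j - ?d m j + ?d (m + 1) j)" if "m < K" for m
    using that
  proof (induction m)
    case 0
    show ?case
      by (rule step[OF reach_start[OF emb], of 0]) (use K in \<open>auto simp: N_def tree_theta_def par_def\<close>)
  next
    case (Suc m)
    then have "?R (\<lambda>j. ?d (K + 1) j - ?d m j + ?d (m + 1) j)" by simp
    then show ?case
      by (rule step[of _ "Suc m"]) (use Suc.prems in \<open>auto simp: N_def tree_theta_def par_def\<close>)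
  qed
  have "?R (\<lambda>j. ?d (K + 1) j - ?d K j + ?d (K + 2) j + ?d (K + 3) j)"
    by (rule step[OF up[of "K - 1"], of K]) (use K in \<open>auto simp: N_def tree_theta_def par_def\<close>)
  then have "?R (\<lambda>j. ?d (K + 1) j - ?d (K + 2) j + ?d (K + 3) j)"
    by (rule step[of _ "K + 2"]) (use K in \<open>auto simp: N_def tree_theta_def par_def\<close>)
  then have "?R (\<lambda>j. ?d (K + 1) j + ?d K j - ?d (K + 2) j - ?d (K + 3) j)"
    by (rule step[of _ "K + 3"]) (use K in \<open>auto simp: N_def tree_theta_def par_def\<close>)
  then have start: "?R (\<lambda>j. ?d (K + 1) j + ?d k j - ?d (Suc k) j)"
    by (rule step[of _ K]) (auto simp: K_def N_def tree_theta_def par_def)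
  \<comment> \<open>The way back: playing \<open>n + 1\<close> passes the 1 to node
    \<open>n\<close>, until it arrives at \<open>v\<close>.\<close>
  have "?R (\<lambda>j. ?d (K + 1) j + ?d n j - ?d (Suc n) j)" if "n \<le> k" for n
    using that
  proof (induction rule: inc_induct)
    case base
    show ?case by (rule start)
  next
    case (step n)
    show ?case
      by (rule reach_step[OF emb step.IH, of "Suc n"])
        (use step.hyps in \<open>auto simp: K_def N_def tree_theta_def par_def\<close>)
  qed
  from this[of 0] have "?R (\<lambda>j. ?d (K + 1) j + ?d 0 j - ?d 1 j)" by simp
  then have "?R (\<lambda>j. - ?d (K + 1) j + 2 * ?d 0 j - ?d 1 j)"
    by (rule step[of _ "K + 1"]) (use K in \<open>auto simp: N_def tree_theta_def par_def\<close>)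
  then show False using reach_le[OF emb, of _ 0] by (force simp: N_def)
qed

section \<open>Decomposition of the tree into a stem and two branches\<close>

lemma unary_descent:
  assumes "b \<in> colors P"
  shows "\<exists>k f. f 0 = b \<and> (\<forall>i<k. \<forall>c. child (f i) c \<longleftrightarrow> c = f (Suc i)) \<and>
    ((\<forall>c. \<not> child (f k) c) \<or> (\<exists>c c'. c \<noteq> c' \<and> child (f k) c \<and> child (f k) c'))"
  using assms
proof (induction "card {z. z \<prec> top b}" arbitrary: b rule: less_induct)
  case less
  show ?case
  proof (cases "\<exists>a. \<forall>c. child b c \<longleftrightarrow> c = a")
    case False
    then have "(\<forall>c. \<not> child b c) \<or> (\<exists>c c'. c \<noteq> c' \<and> child b c \<and> child b c')" by metis
    then show ?thesis by (intro exI[of _ 0] exI[of _ "\<lambda>_. b"]) auto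
  next
    case True
    then obtain a where a: "\<And>c. child b c \<longleftrightarrow> c = a" by auto
    then obtain k f where kf: "f 0 = a" "\<forall>i<k. \<forall>c. child (f i) c \<longleftrightarrow> c = f (Suc i)"
      "(\<forall>c. \<not> child (f k) c) \<or> (\<exists>c c'. c \<noteq> c' \<and> child (f k) c \<and> child (f k) c')"
      using less.hyps[of a] card_down_less childD(2,4)[of b a] by metis
    let ?f = "\<lambda>i. case i of 0 \<Rightarrow> b | Suc j \<Rightarrow> f j"
    show ?thesis
    proof (intro exI conjI)
      show "\<forall>i<Suc k. \<forall>c. child (?f i) c \<longleftrightarrow> c = ?f (Suc i)"
        using a kf by (auto simp: less_Suc_eq_0_disj)
    qed (use kf in auto)
  qed
qed

lemma colors_subset_closed:
  assumes "\<And>r. root r \<Longrightarrow> r \<in> S" "\<And>a b. a \<in> S \<Longrightarrow> child a b \<Longrightarrow> b \<in> S"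
  shows "colors P \<subseteq> S"
proof
  fix b assume "b \<in> colors P"
  then show "b \<in> S"
  proof (induction "card {z. top b \<prec> z}" arbitrary: b rule: less_induct)
    case less
    show ?case
    proof (cases "root b")
      case False
      then obtain a where a: "child a b" using less.prems by (auto simp: root_def)
      then show ?thesis
        using less.hyps[of a] card_up_less childD(1,4)[OF a] assms by blast
    qed (use assms in auto)
  qed
qed

text \<open>The stem has \<open>s\<close> edges and the branches have \<open>p\<close> and
  \<open>q\<close> nodes, ordered to avoid mirror cases. Here the tree is the whole diagram, in
  contrast to \<open>embedded_tree\<close>.\<close>

definition shaped :: "(nat \<Rightarrow> 'c) \<Rightarrow> nat \<Rightarrow> nat \<Rightarrow> nat \<Rightarrow> bool" where
  "shaped e s p q \<longleftrightarrow> 1 \<le> p \<and> p \<le> q \<and> embedded_tree e (shape_par s p) (s + p + q + 1) \<and>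
     e ` {..<s + p + q + 1} = colors P \<and> root (e 0)"

text \<open>Stem and branches are concatenated into one numbering. Its range is everything because
  it contains the root and is closed under children: along the chains the child is unique, and by
  \<open>at_most_two_children\<close> the lower end of the stem has only \<open>u\<close> and
  \<open>v\<close>.\<close>

lemma shaped_aux:
  assumes r: "root r" "f 0 = r" "\<And>i c. i < s \<Longrightarrow> child (f i) c \<longleftrightarrow> c = f (Suc i)"
    and c: "child (f s) u" "child (f s) v" "u \<noteq> v"
    and g: "g 0 = u" "\<And>i c. i < k \<Longrightarrow> child (g i) c \<longleftrightarrow> c = g (Suc i)" "\<And>c. \<not> child (g k) c"
    and h: "h 0 = v" "\<And>i c. i < l \<Longrightarrow> child (h i) c \<longleftrightarrow> c = h (Suc i)" "\<And>c. \<not> child (h l) c"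
    and kl: "k \<le> l"
  shows "\<exists>e s p q. shaped e s p q"
proof -
  define p q where "p = Suc k" and "q = Suc l"
  define e where "e = (\<lambda>i. if i \<le> s then f i else if i \<le> s + p then g (i - s - 1) else h (i - s - p - 1))"
  define N where "N = s + p + q + 1"
  have cases_lt: "i \<le> s \<or> (\<exists>j\<le>k. i = s + 1 + j) \<or> (\<exists>j\<le>l. i = s + p + 1 + j)" if "i < N" for i
    using that unfolding N_def p_def q_def by presburger
  have e_f: "e i = f i" if "i \<le> s" for i using that by (simp add: e_def)
  have e_g: "e (s + 1 + j) = g j" if "j \<le> k" for j using that by (simp add: e_def p_def)
  have e_h: "e (s + p + 1 + j) = h j" for j by (simp add: e_def)
  have emb: "embedded_tree e (shape_par s p) N"
    unfolding embedded_tree_def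
  proof (intro conjI allI impI)
    fix i assume i: "0 < i \<and> i < N"
    show "shape_par s p i < i" using i by (auto simp: shape_par_def)
    have "i < N" using i by simp
    from cases_lt[OF this] show "child (e (shape_par s p i)) (e i)"
    proof (elim disjE exE conjE)
      assume "i \<le> s"
      then obtain j where "i = Suc j" "j < s" using i by (cases i) auto
      then show ?thesis using r e_f[of j] e_f[of "Suc j"] by (simp add: shape_par_def p_def)
    next
      fix j assume j: "j \<le> k" "i = s + 1 + j"
      show ?thesis
      proof (cases j)
        case 0
        then show ?thesis using j c g e_f[of s] e_g[of 0] by (simp add: shape_par_def p_def)
      next
        case (Suc m)
        then show ?thesis using j g e_g[of m] e_g[of "Suc m"] by (simp add: shape_par_def p_def)
      qed
    next
      fix j assume j: "j \<le> l" "i = s + p + 1 + j"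
      show ?thesis
      proof (cases j)
        case 0
        then show ?thesis using j c h e_f[of s] e_h[of 0] by (simp add: shape_par_def)
      next
        case (Suc m)
        then show ?thesis using j h e_h[of m] e_h[of "Suc m"] by (simp add: shape_par_def)
      qed
    qed
  next
    fix i j assume ij: "0 < i \<and> i < j \<and> j < N \<and> shape_par s p i = shape_par s p j"
    then have "i = s + 1 \<and> j = s + p + 1" by (auto simp: shape_par_def split: if_splits)
    then show "e i \<noteq> e j" using e_g[of 0] e_h[of 0] g h c by simp
  next
    show "e 0 \<in> colors P" using r e_f[of 0] by (simp add: root_def)
  qed (simp add: N_def)
  have "e ` {..<N} = colors P"
  proof
    show "e ` {..<N} \<subseteq> colors P" using embedded_in[OF emb] by auto
    show "colors P \<subseteq> e ` {..<N}"
    proof (rule colors_subset_closed)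
      fix r' assume "root r'"
      then have "r' = e 0" using root_unique r e_f by auto
      then show "r' \<in> e ` {..<N}" by (auto simp: N_def)
    next
      fix a b assume "a \<in> e ` {..<N}" and ab: "child a b"
      then obtain i where i: "i < N" "a = e i" by auto
      have "\<exists>j<N. b = e j"
        using cases_lt[OF i(1)]
      proof (elim disjE exE conjE)
        assume "i \<le> s"
        show ?thesis
        proof (cases "i = s")
          case True
          then have "b = u \<or> b = v" using at_most_two_children[OF c(1,2), of b] ab i c(3) e_f by auto
          then show ?thesis
            using e_g[of 0] e_h[of 0] g h by (auto simp: N_def p_def q_def intro: exI[of _ "s + 1"] exI[of _ "s + p + 1"])
        next
          case False
          then have "b = e (Suc i)" using ab i r(3)[of i] e_f[of i] e_f[of "Suc i"] \<open>i \<le> s\<close> by simp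
          then show ?thesis using False \<open>i \<le> s\<close> unfolding N_def by (intro exI[of _ "Suc i"]) auto
        qed
      next
        fix j assume j: "j \<le> k" "i = s + 1 + j"
        then have "j < k" using ab i g(3) e_g[of j] by (cases "j = k") auto
        then have "b = e (s + 1 + Suc j)" using ab i j g(2)[of j] e_g[of j] e_g[of "Suc j"] by simp
        then show ?thesis using \<open>j < k\<close> unfolding N_def p_def by (intro exI[of _ "s + 1 + Suc j"]) simp
      next
        fix j assume j: "j \<le> l" "i = s + p + 1 + j"
        then have "j < l" using ab i h(3) e_h[of j] by (cases "j = l") auto
        then have "b = e (s + p + 1 + Suc j)" using ab i j h(2)[of j] e_h[of j] e_h[of "Suc j"] by simp
        then show ?thesis using \<open>j < l\<close> unfolding N_def q_def by (intro exI[of _ "s + p + 1 + Suc j"]) simp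
      qed
      then show "b \<in> e ` {..<N}" by auto
    qed
  qed
  then have "shaped e s p q"
    using emb kl r e_f[of 0] by (simp add: shaped_def N_def p_def q_def)
  then show ?thesis by blast
qed

text \<open>Follow single children from the root. The descent must stop at a branching node, since
  otherwise all colors would lie on one chain and \<open>x\<close> could not have two children.
  Below it \<open>no_nested_branching\<close> leaves two chains.\<close>

lemma branching_shaped:
  assumes "child x y" "child x y'" "y \<noteq> y'"
  shows "\<exists>e s p q. shaped e s p q"
proof -
  obtain r where "root_above r x" using ex_root_above[OF childD(1)[OF assms(1)]] .
  then have r: "root r" by (simp add: root_above_def)
  then have "r \<in> colors P" by (simp add: root_def)
  then obtain s f where f: "f 0 = r" "\<And>i c. i < s \<Longrightarrow> child (f i) c \<longleftrightarrow> c = f (Suc i)"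
    and fs: "(\<forall>c. \<not> child (f s) c) \<or> (\<exists>c c'. c \<noteq> c' \<and> child (f s) c \<and> child (f s) c')"
    using unary_descent[of r] by metis
  have "\<exists>c c'. c \<noteq> c' \<and> child (f s) c \<and> child (f s) c'"
  proof (rule ccontr)
    assume "\<not> ?thesis"
    then have leaf: "\<And>c. \<not> child (f s) c" using fs by blast
    have "colors P \<subseteq> f ` {..s}"
    proof (rule colors_subset_closed)
      show "r' \<in> f ` {..s}" if "root r'" for r' using root_unique[OF that r] f by auto
      fix a b assume "a \<in> f ` {..s}" and ab: "child a b"
      then obtain i where i: "i \<le> s" "a = f i" by auto
      then have "i < s" using leaf ab by (cases "i = s") auto
      then show "b \<in> f ` {..s}" using f(2)[of i b] ab i by auto
    qed
    then obtain i where "i \<le> s" "x = f i" using childD(1)[OF assms(1)] by auto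
    then show False using leaf f(2)[of i] assms by (cases "i = s") auto
  qed
  then obtain u v where uv: "u \<noteq> v" "child (f s) u" "child (f s) v" by blast
  have desc: "\<exists>k g. g 0 = a \<and> (\<forall>i<k. \<forall>c. child (g i) c \<longleftrightarrow> c = g (Suc i)) \<and> (\<forall>c. \<not> child (g k) c)"
    if a: "child (f s) a" "child (f s) a'" "a \<noteq> a'" for a a'
  proof -
    obtain k g where g: "g 0 = a" "\<forall>i<k. \<forall>c. child (g i) c \<longleftrightarrow> c = g (Suc i)"
      "(\<forall>c. \<not> child (g k) c) \<or> (\<exists>c c'. c \<noteq> c' \<and> child (g k) c \<and> child (g k) c')"
      using unary_descent[OF childD(2)[OF a(1)]] by metis
    then show ?thesis using no_nested_branching[OF a, of g k] by blast
  qed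
  obtain k g where g: "g 0 = u" "\<And>i c. i < k \<Longrightarrow> child (g i) c \<longleftrightarrow> c = g (Suc i)" "\<And>c. \<not> child (g k) c"
    using desc[of u v] uv by metis
  obtain l h where h: "h 0 = v" "\<And>i c. i < l \<Longrightarrow> child (h i) c \<longleftrightarrow> c = h (Suc i)" "\<And>c. \<not> child (h l) c"
    using desc[of v u] uv by metis
  show ?thesis
  proof (cases "k \<le> l")
    case True
    then show ?thesis using shaped_aux[OF r f uv(2,3,1) g h] by blast
  next
    case False
    then show ?thesis using shaped_aux[OF r f uv(3,2) uv(1)[symmetric] h g] by simp
  qed
qed

section \<open>Bounds on the lengths of stem and branches\<close>

lemma embedded_subtree:
  assumes emb: "embedded_tree e par N" and N': "0 < N'"
    and f: "\<And>i. i < N' \<Longrightarrow> f i < N" "inj_on f {..<N'}"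
    and par': "\<And>i. 0 < i \<Longrightarrow> i < N' \<Longrightarrow> par' i < i \<and> 0 < f i \<and> par (f i) = f (par' i)"
  shows "embedded_tree (e \<circ> f) par' N'"
  unfolding embedded_tree_def
proof (intro conjI allI impI)
  show "0 < N'" by fact
  show "(e \<circ> f) 0 \<in> colors P" using f N' embedded_in[OF emb] by simp
next
  fix i assume i: "0 < i \<and> i < N'"
  then show "par' i < i" using par' by simp
  show "child ((e \<circ> f) (par' i)) ((e \<circ> f) i)"
    using par'[of i] embedded_child[OF emb, of "f i"] f i by auto
next
  fix i j assume "0 < i \<and> i < j \<and> j < N' \<and> par' i = par' j"
  then show "(e \<circ> f) i \<noteq> (e \<circ> f) j"
    using f(1)[of i] f(1)[of j] inj_onD[OF f(2), of i j] inj_onD[OF embedded_inj[OF emb], of "f i" "f j"]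
    by auto
qed

lemma embedded_list_overflow:
  assumes emb: "embedded_tree e par N" and len: "length fs = length ps" "0 < length ps"
    and f: "\<forall>x\<in>set fs. x < N" "distinct fs"
    and par: "list_all (\<lambda>i. ps ! i < i \<and> 0 < fs ! i \<and> par (fs ! i) = fs ! (ps ! i)) [1..<length ps]"
    and over: "\<exists>k\<in>set (play ((!) ps) w (1 # replicate (length ps - 1) 0)). 1 < k"
  shows False
proof -
  have "embedded_tree (e \<circ> (!) fs) ((!) ps) (length ps)"
    using emb
  proof (rule embedded_subtree)
    show "inj_on ((!) fs) {..<length ps}" using f len by (auto simp: inj_on_nth)
  qed (use len f par in \<open>auto simp: list_all_iff\<close>)
  then show False using over by (rule play_no_overflow)
qed

text \<open>The excluded trees are the diagrams E6, E7 and E8 rooted at the adjoint node, where the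
  highest root has a coefficient 2.\<close>

lemma play_E6_adjoint:
  "\<exists>k\<in>set (play ((!) [0, 0, 1, 2, 1, 4]) [0, 1, 2, 3, 4, 1, 0, 2, 1, 4]
     (1 # replicate (length [0, 0, 1, 2, 1, 4 :: nat] - 1) 0)). 1 < k"
  by code_simp

lemma play_E7_adjoint:
  "\<exists>k\<in>set (play ((!) [0, 0, 1, 2, 2, 4, 5]) [0, 1, 2, 3, 4, 2, 1, 0, 5, 4, 2, 1, 3, 2, 4, 5]
     (1 # replicate (length [0, 0, 1, 2, 2, 4, 5 :: nat] - 1) 0)). 1 < k"
  by code_simp

lemma play_E8_adjoint:
  "\<exists>k\<in>set (play ((!) [0, 0, 1, 2, 3, 4, 4, 6])
     [0, 1, 2, 3, 4, 5, 6, 4, 3, 2, 1, 0, 7, 6, 4, 3, 2, 1, 5, 4, 3, 2, 6, 4, 3, 5, 4, 6]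
     (1 # replicate (length [0, 0, 1, 2, 3, 4, 4, 6 :: nat] - 1) 0)). 1 < k"
  by code_simp

text \<open>A triple outside the list has arms long enough to contain an excluded tree around its
  branching node. That tree is rooted at stem node \<open>t = s - 1\<close>, \<open>s - 2\<close> or
  \<open>s - 4\<close> for E6, E7 or E8; the stem above \<open>t\<close> is ignored, as a subgame
  may start at any node.\<close>

lemma shaped_cases:
  assumes "shaped e s p q"
  shows "s = 0 \<or> s = 1 \<and> p = 1 \<or> p = 1 \<and> q = 1 \<or> (s = 2 \<or> s = 3) \<and> p = 1 \<and> q = 2"
proof (rule ccontr)
  assume neg: "\<not> ?thesis"
  have emb: "embedded_tree e (shape_par s p) (s + p + q + 1)" and pq: "1 \<le> p" "p \<le> q"
    using assms by (auto simp: shaped_def)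
  have "1 \<le> s \<and> 2 \<le> p \<and> 2 \<le> q \<or> 2 \<le> s \<and> p = 1 \<and> 3 \<le> q \<or> 4 \<le> s \<and> p = 1 \<and> 2 \<le> q"
    using neg pq by presburger
  then consider (E6) "1 \<le> s" "2 \<le> p" "2 \<le> q" | (E7) "2 \<le> s" "p = 1" "3 \<le> q"
    | (E8) "4 \<le> s" "p = 1" "2 \<le> q"
    by blast
  then show False
  proof cases
    case E6
    then obtain t where "s = t + 1" using le_Suc_ex[of 1 s] by auto
    show False
    proof (rule embedded_list_overflow[OF emb _ _ _ _ _ play_E6_adjoint, of "[t, t + 1, t + 2, t + 3, t + p + 2, t + p + 3]"])
      show "list_all (\<lambda>i. [0, 0, 1, 2, 1, 4] ! i < i \<and> 0 < [t, t + 1, t + 2, t + 3, t + p + 2, t + p + 3] ! i \<and>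
          shape_par s p ([t, t + 1, t + 2, t + 3, t + p + 2, t + p + 3] ! i) = [t, t + 1, t + 2, t + 3, t + p + 2, t + p + 3] ! ([0, 0, 1, 2, 1, 4] ! i))
          [1..<length [0, 0, 1, 2, 1, 4 :: nat]]"
        using E6 \<open>s = _\<close> by (simp add: shape_par_def upt_rec)
    qed (use E6 \<open>s = _\<close> in auto)
  next
    case E7
    then obtain t where "s = t + 2" using le_Suc_ex[of 2 s] by auto
    show False
    proof (rule embedded_list_overflow[OF emb _ _ _ _ _ play_E7_adjoint, of "[t, t + 1, t + 2, t + 3, t + 4, t + 5, t + 6]"])
      show "list_all (\<lambda>i. [0, 0, 1, 2, 2, 4, 5] ! i < i \<and> 0 < [t, t + 1, t + 2, t + 3, t + 4, t + 5, t + 6] ! i \<and>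
          shape_par s p ([t, t + 1, t + 2, t + 3, t + 4, t + 5, t + 6] ! i) = [t, t + 1, t + 2, t + 3, t + 4, t + 5, t + 6] ! ([0, 0, 1, 2, 2, 4, 5] ! i))
          [1..<length [0, 0, 1, 2, 2, 4, 5 :: nat]]"
        using E7 \<open>s = _\<close> by (simp add: shape_par_def upt_rec)
    qed (use E7 \<open>s = _\<close> in auto)
  next
    case E8
    then obtain t where "s = t + 4" using le_Suc_ex[of 4 s] by auto
    show False
    proof (rule embedded_list_overflow[OF emb _ _ _ _ _ play_E8_adjoint, of "[t, t + 1, t + 2, t + 3, t + 4, t + 5, t + 6, t + 7]"])
      show "list_all (\<lambda>i. [0, 0, 1, 2, 3, 4, 4, 6] ! i < i \<and> 0 < [t, t + 1, t + 2, t + 3, t + 4, t + 5, t + 6, t + 7] ! i \<and>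
          shape_par s p ([t, t + 1, t + 2, t + 3, t + 4, t + 5, t + 6, t + 7] ! i) = [t, t + 1, t + 2, t + 3, t + 4, t + 5, t + 6, t + 7] ! ([0, 0, 1, 2, 3, 4, 4, 6] ! i))
          [1..<length [0, 0, 1, 2, 3, 4, 4, 6 :: nat]]"
        using E8 \<open>s = _\<close> by (simp add: shape_par_def upt_rec)
    qed (use E8 \<open>s = _\<close> in auto)
  qed
qed

text \<open>With at most one child everywhere, \<open>wt_tops\<close> leaves no positive weight on
  the filter of tops, so nothing can be added to it.\<close>

lemma no_branching_all_tops:
  assumes "\<And>x y y'. child x y \<Longrightarrow> child x y' \<Longrightarrow> y = y'"
  shows "elems P = top ` colors P"
proof -
  have "wt (top ` colors P) b \<le> 0" if b: "b \<in> colors P" for b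
  proof -
    have "card {a. child b a} \<le> 1"
    proof -
      have "{a. child b a} \<subseteq> colors P" using childD(2) by blast
      then have "finite {a. child b a}" by (rule finite_subset) simp
      then have "card {a. child b a} \<le> Suc 0"
        unfolding card_le_Suc0_iff_eq[OF \<open>finite {a. child b a}\<close>]
      proof (intro ballI)
        fix a a' assume "a \<in> {a. child b a}" "a' \<in> {a. child b a}"
        then show "a = a'" using assms[of b a a'] by simp
      qed
      then show ?thesis by simp
    qed
    then show ?thesis using wt_tops[OF b] by simp
  qed
  then show ?thesis by (rule upset_all[OF upset_tops, symmetric])
qed

lemma slant_irreducible_branching:
  assumes "slant_irreducible P" "card (colors P) > 1"
  obtains x y y' where "child x y" "child x y'" "y \<noteq> y'"
proof (rule ccontr)
  assume "\<not> thesis"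
  then have all: "elems P = top ` colors P" using no_branching_all_tops that by blast
  obtain b where b: "b \<in> colors P" "\<not> root b"
  proof -
    have "\<exists>b\<in>colors P. \<not> root b"
    proof (rule ccontr)
      assume "\<not> ?thesis"
      then have "\<forall>x\<in>colors P. \<forall>y\<in>colors P. x = y" using root_unique by blast
      then have "card (colors P) \<le> Suc 0"
        unfolding card_le_Suc0_iff_eq[OF finite_colors] .
      then show False using assms(2) by simp
    qed
    then show thesis using that by blast
  qed
  then obtain a0 where "child a0 b" by (auto simp: root_def)
  then obtain a where a: "child a b" "covered_by P (top b) (top a)"
    using child_cover[OF b(1)] childD(4) by metis
  have "\<exists>w\<in>elems P. w \<noteq> top a \<and> color P w = color P (top a)"
    using assms(1) a(2) maximal_top[OF b(1)] maximal_top[OF childD(1)[OF a(1)]]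
    unfolding slant_irreducible_def top_tree_def by blast
  then obtain c where "c \<in> colors P" "top c \<noteq> top a" "col (top c) = col (top a)"
    unfolding all by blast
  then show False using col_top childD(1)[OF a(1)] by metis
qed

lemma ex_shaped:
  assumes "slant_irreducible P" "card (colors P) > 1"
  shows "\<exists>e s p q. shaped e s p q"
  using slant_irreducible_branching[OF assms] branching_shaped by metis

end


section \<open>Matching the game with a listed poset\<close>

text \<open>Counterparts of AC and of \<open>adjacent_cover\<close>: these two properties let the
  order of \<open>Q\<close> be recovered from the order of play and the colors.\<close>

definition heap_poset :: "('b, 'd) colored_poset \<Rightarrow> bool" where
  "heap_poset Q \<longleftrightarrow> (\<forall>x\<in>elems Q. (x, x) \<in> ord Q) \<and> trans (ord Q) \<and>
     color Q ` elems Q \<subseteq> colors Q \<and>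
     (\<forall>x\<in>elems Q. \<forall>y\<in>elems Q. theta Q (color Q x) (color Q y) = -1 \<longrightarrow> comparable Q x y) \<and>
     (\<forall>x y. less_in Q x y \<longrightarrow>
        (\<exists>z. less_in Q x z \<and> (z, y) \<in> ord Q \<and> theta Q (color Q z) (color Q x) = -1))"

text \<open>The new set and the new weights enter through equations, so that sets and weight
  functions in any convenient form can be matched. Weights are compared on \<open>colors Q\<close>
  only.\<close>

inductive plays :: "('b, 'd) colored_poset \<Rightarrow> ('d \<Rightarrow> int) \<Rightarrow> 'b set \<Rightarrow> ('d \<Rightarrow> int) \<Rightarrow> bool"
  for Q \<omega> where
  start: "(\<And>c. c \<in> colors Q \<Longrightarrow> \<mu> c = \<omega> c) \<Longrightarrow> plays Q \<omega> {} \<mu>"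
| step: "plays Q \<omega> A \<mu> \<Longrightarrow> y \<in> elems Q \<Longrightarrow> y \<notin> A \<Longrightarrow> (\<And>z. less_in Q y z \<Longrightarrow> z \<in> A) \<Longrightarrow>
    \<mu> (color Q y) = 1 \<Longrightarrow> A' = insert y A \<Longrightarrow>
    (\<And>c. c \<in> colors Q \<Longrightarrow> \<nu> c = \<mu> c - theta Q (color Q y) c) \<Longrightarrow> plays Q \<omega> A' \<nu>"

lemma plays_cong:
  assumes "plays Q \<omega> A \<mu>" "\<And>c. c \<in> colors Q \<Longrightarrow> \<nu> c = \<mu> c"
  shows "plays Q \<omega> A \<nu>"
  using assms by (cases) (auto intro: plays.intros)

lemma plays_upset:
  assumes "plays Q \<omega> A \<mu>"
  shows "A \<subseteq> elems Q \<and> (\<forall>x\<in>A. \<forall>y. less_in Q x y \<longrightarrow> y \<in> A)"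
  using assms by induction auto

context minuscule_game
begin

text \<open>A move of \<open>Q\<close> has weight 1 in \<open>P\<close> as well, so
  \<open>wt_1_extend\<close> supplies an element \<open>x\<close> of the right color. Played
  elements of adjacent color are comparable to \<open>x\<close> and therefore above it. On both
  sides the new element lies below a played one exactly if some played element of adjacent color
  lies in between or equals it, so the orders agree.\<close>

lemma plays_match:
  assumes \<gamma>: "bij_betw \<gamma> (colors Q) (colors P)"
      "\<And>a b. a \<in> colors Q \<Longrightarrow> b \<in> colors Q \<Longrightarrow> th (\<gamma> a) (\<gamma> b) = theta Q a b"
    and Q: "heap_poset Q"
    and start: "\<And>c. c \<in> colors Q \<Longrightarrow> lam (\<gamma> c) = \<omega> c"
    and "plays Q \<omega> A \<mu>"
  shows "\<exists>f. inj_on f A \<and> upset (f ` A) \<and> (\<forall>z\<in>A. col (f z) = \<gamma> (color Q z)) \<and>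
    (\<forall>z\<in>A. \<forall>w\<in>A. (f z, f w) \<in> ord P \<longleftrightarrow> (z, w) \<in> ord Q) \<and>
    (\<forall>c\<in>colors Q. wt (f ` A) (\<gamma> c) = \<mu> c)"
  using assms(5)
proof induction
  case (start \<mu>)
  then show ?case using assms(4) by (auto simp: upset_def wt_def)
next
  case (step A \<mu> y A' \<nu>)
  have Qt: "\<And>x y z. (x, y) \<in> ord Q \<Longrightarrow> (y, z) \<in> ord Q \<Longrightarrow> (x, z) \<in> ord Q"
    and Qc: "\<And>x. x \<in> elems Q \<Longrightarrow> color Q x \<in> colors Q"
    and Qac: "\<And>x y. x \<in> elems Q \<Longrightarrow> y \<in> elems Q \<Longrightarrow> theta Q (color Q x) (color Q y) = -1 \<Longrightarrow>
      (x, y) \<in> ord Q \<or> (y, x) \<in> ord Q"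
    and Qna: "\<And>x y. less_in Q x y \<Longrightarrow>
      \<exists>z. less_in Q x z \<and> (z, y) \<in> ord Q \<and> theta Q (color Q z) (color Q x) = -1"
    and Qr: "\<And>x. x \<in> elems Q \<Longrightarrow> (x, x) \<in> ord Q"
    using Q unfolding heap_poset_def comparable_def by (blast dest: transD)+
  have Pt: "\<And>x y z. (x, y) \<in> ord P \<Longrightarrow> (y, z) \<in> ord P \<Longrightarrow> (x, z) \<in> ord P"
    using po unfolding partial_order_on_def preorder_on_def by (blast dest: transD)
  have A: "A \<subseteq> elems Q" "\<And>x y. x \<in> A \<Longrightarrow> less_in Q x y \<Longrightarrow> y \<in> A"
    using plays_upset[OF step.hyps(1)] by auto
  obtain f where f: "inj_on f A" "upset (f ` A)" "\<And>z. z \<in> A \<Longrightarrow> col (f z) = \<gamma> (color Q z)"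
    "\<And>z w. z \<in> A \<Longrightarrow> w \<in> A \<Longrightarrow> (f z, f w) \<in> ord P \<longleftrightarrow> (z, w) \<in> ord Q"
    "\<And>c. c \<in> colors Q \<Longrightarrow> wt (f ` A) (\<gamma> c) = \<mu> c"
    using step.IH by blast
  have fP: "f z \<in> elems P" if "z \<in> A" for z using f(2) that by (auto simp: upset_def)
  have up: "w \<in> f ` A" if "z \<in> A" "f z \<prec> w" for z w using f(2) that unfolding upset_def by blast
  have yc: "color Q y \<in> colors Q" "\<gamma> (color Q y) \<in> colors P"
    using Qc[OF step.hyps(2)] \<gamma>(1) by (auto dest: bij_betwE)
  have "wt (f ` A) (\<gamma> (color Q y)) = 1" using f(5)[OF yc(1)] step.hyps(5) by simp
  then obtain x where x: "x \<in> elems P" "x \<notin> f ` A" "col x = \<gamma> (color Q y)" "upset (insert x (f ` A))"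
    "\<And>c. wt (insert x (f ` A)) c = wt (f ` A) c - th (\<gamma> (color Q y)) c"
    using wt_1_extend[OF f(2) yc(2)] by metis
  have above: "(x, f z) \<in> ord P \<longleftrightarrow> (y, z) \<in> ord Q" if z: "z \<in> A" for z
  proof
    assume "(x, f z) \<in> ord P"
    moreover have "x \<noteq> f z" using x(2) z by blast
    ultimately have "x \<prec> f z" using x(1) fP[OF z] by (simp add: less_in_def)
    then obtain w where w: "covered_by P x w" "w = f z \<or> w \<prec> f z" "th (col w) (col x) = -1"
      by (rule adjacent_cover)
    then have "w \<in> insert x (f ` A)" "w \<noteq> x"
      using x(4) unfolding upset_def covered_by_def by (auto dest: ltD)
    then obtain z' where z': "z' \<in> A" "w = f z'" by blast
    have "theta Q (color Q z') (color Q y) = -1"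
      using w(3) z' x(3) f(3) \<gamma>(2) yc Qc A(1) by auto
    then have "(z', y) \<in> ord Q \<or> (y, z') \<in> ord Q"
      using Qac[of z' y] z' A(1) step.hyps(2) by auto
    moreover have "(z', y) \<notin> ord Q"
      using A z' step.hyps(2,3) unfolding less_in_def by blast
    moreover have "(z', z) \<in> ord Q"
    proof -
      have "(w, f z) \<in> ord P" using w(2) ord_refl[OF fP[OF z]] by (auto dest: ltD)
      then show ?thesis using f(4)[OF z'(1) z] z' by simp
    qed
    ultimately show "(y, z) \<in> ord Q" using Qt by blast
  next
    assume "(y, z) \<in> ord Q"
    then have "less_in Q y z" using z A(1) step.hyps(2,3) by (auto simp: less_in_def)
    then obtain z' where z': "less_in Q y z'" "(z', z) \<in> ord Q" "theta Q (color Q z') (color Q y) = -1"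
      using Qna by blast
    have zA: "z' \<in> A" using step.hyps(4) z' by blast
    have "th (col (f z')) (col x) = -1"
      using z'(3) zA x(3) f(3) \<gamma>(2) yc Qc A(1) by auto
    moreover have "f z' \<noteq> x" using x(2) zA by blast
    ultimately have "f z' \<prec> x \<or> x \<prec> f z'"
      using related_comparable[OF fP[OF zA] x(1)] by simp
    then have "x \<prec> f z'" using up[OF zA] x(2) by blast
    then show "(x, f z) \<in> ord P" using f(4)[OF zA z] z'(2) Pt by (blast dest: ltD)
  qed
  have below: "(f z, x) \<notin> ord P" "(z, y) \<notin> ord Q" if z: "z \<in> A" for z
  proof -
    show "(f z, x) \<notin> ord P"
      using up[OF z, of x] x(1,2) fP[OF z] z unfolding less_in_def by blast
    show "(z, y) \<notin> ord Q" using A z step.hyps(2,3) unfolding less_in_def by blast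
  qed
  let ?f = "f(y := x)"
  have im: "?f ` A' = insert x (f ` A)" and eq: "\<And>z. z \<in> A \<Longrightarrow> ?f z = f z"
    using step.hyps(3,6) by auto
  show ?case
  proof (intro exI[of _ ?f] conjI)
    show "inj_on ?f A'" using f(1) x(2) step.hyps(3,6) by (auto simp: inj_on_def)
    show "upset (?f ` A')" using x(4) im by simp
    show "\<forall>z\<in>A'. col (?f z) = \<gamma> (color Q z)" using f(3) x(3) step.hyps(6) by auto
    show "\<forall>z\<in>A'. \<forall>w\<in>A'. (?f z, ?f w) \<in> ord P \<longleftrightarrow> (z, w) \<in> ord Q"
      using f(4) above below ord_refl[OF x(1)] Qr[OF step.hyps(2)] step.hyps(3,6) eq by auto
    show "\<forall>c\<in>colors Q. wt (?f ` A') (\<gamma> c) = \<nu> c"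
      using im x(5) f(5) \<gamma>(2)[OF yc(1)] step.hyps(7) by simp
  qed
qed

lemma plays_isomorphic:
  assumes \<gamma>: "bij_betw \<gamma> (colors Q) (colors P)"
      "\<And>a b. a \<in> colors Q \<Longrightarrow> b \<in> colors Q \<Longrightarrow> th (\<gamma> a) (\<gamma> b) = theta Q a b"
    and Q: "heap_poset Q"
    and start: "\<And>c. c \<in> colors Q \<Longrightarrow> lam (\<gamma> c) = \<omega> c"
    and plays: "plays Q \<omega> (elems Q) \<mu>" and le0: "\<And>c. c \<in> colors Q \<Longrightarrow> \<mu> c \<le> 0"
  shows "gamma_isomorphic P Q"
proof -
  obtain f where f: "inj_on f (elems Q)" "upset (f ` elems Q)"
    "\<And>z. z \<in> elems Q \<Longrightarrow> col (f z) = \<gamma> (color Q z)"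
    "\<And>z w. z \<in> elems Q \<Longrightarrow> w \<in> elems Q \<Longrightarrow> (f z, f w) \<in> ord P \<longleftrightarrow> (z, w) \<in> ord Q"
    "\<And>c. c \<in> colors Q \<Longrightarrow> wt (f ` elems Q) (\<gamma> c) = \<mu> c"
    using plays_match[OF \<gamma> Q start plays] by blast
  have "wt (f ` elems Q) b \<le> 0" if "b \<in> colors P" for b
    using that \<gamma>(1) f(5) le0 by (metis bij_betw_imp_surj_on imageE)
  then have "f ` elems Q = elems P" using upset_all[OF f(2)] by blast
  then have bf: "bij_betw f (elems Q) (elems P)" using f(1) by (simp add: bij_betw_def)
  \<comment> \<open>The copy was built from \<open>Q\<close> into \<open>P\<close>, whereas
    \<open>gamma_isomorphic P Q\<close> asks for maps from \<open>P\<close> to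
    \<open>Q\<close>.\<close>
  let ?\<pi> = "inv_into (elems Q) f" and ?g = "inv_into (colors Q) \<gamma>"
  have \<pi>: "?\<pi> x \<in> elems Q" "f (?\<pi> x) = x" if "x \<in> elems P" for x
    using bf that by (auto simp: bij_betw_def inv_into_into f_inv_into_f)
  have g: "?g a \<in> colors Q" "\<gamma> (?g a) = a" if "a \<in> colors P" for a
    using \<gamma>(1) that by (auto simp: bij_betw_def inv_into_into f_inv_into_f)
  have Qc: "\<And>x. x \<in> elems Q \<Longrightarrow> color Q x \<in> colors Q" using Q by (auto simp: heap_poset_def)
  show ?thesis
    unfolding gamma_isomorphic_def
  proof (intro exI[of _ ?\<pi>] exI[of _ ?g] conjI ballI)
    show "bij_betw ?\<pi> (elems P) (elems Q)" by (rule bij_betw_inv_into[OF bf])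
    show "bij_betw ?g (colors P) (colors Q)" by (rule bij_betw_inv_into[OF \<gamma>(1)])
    show "(?\<pi> x, ?\<pi> y) \<in> ord Q \<longleftrightarrow> (x, y) \<in> ord P" if "x \<in> elems P" "y \<in> elems P" for x y
      using f(4)[of "?\<pi> x" "?\<pi> y"] \<pi> that by simp
    show "theta Q (?g a) (?g b) = th a b" if "a \<in> colors P" "b \<in> colors P" for a b
      using \<gamma>(2)[of "?g a" "?g b"] g that by simp
    show "color Q (?\<pi> x) = ?g (col x)" if "x \<in> elems P" for x
    proof -
      have "\<gamma> (color Q (?\<pi> x)) = col x" using f(3)[of "?\<pi> x"] \<pi>[OF that] by simp
      then show ?thesis
        using Qc[OF \<pi>(1)[OF that]] \<gamma>(1) by (metis bij_betw_inv_into_left)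
    qed
  qed
qed

lemma shaped_isomorphic:
  assumes sh: "shaped e s p q"
    and k: "bij_betw k {..<s + p + q + 1} (colors Q)"
      "\<And>i j. i < s + p + q + 1 \<Longrightarrow> j < s + p + q + 1 \<Longrightarrow>
        theta Q (k i) (k j) = tree_theta (shape_par s p) i j"
    and Q: "heap_poset Q"
    and plays: "plays Q (\<lambda>c. if c = k 0 then 1 else 0) (elems Q) \<mu>"
    and le0: "\<And>c. c \<in> colors Q \<Longrightarrow> \<mu> c \<le> 0"
  shows "gamma_isomorphic P Q"
proof -
  let ?N = "s + p + q + 1"
  let ?\<gamma> = "e \<circ> inv_into {..<?N} k"
  have emb: "embedded_tree e (shape_par s p) ?N" and e: "e ` {..<?N} = colors P" "root (e 0)"
    using sh by (auto simp: shaped_def)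
  have g: "\<exists>i<?N. c = k i \<and> ?\<gamma> c = e i" if "c \<in> colors Q" for c
  proof -
    have "c \<in> k ` {..<?N}" using that k(1) by (simp add: bij_betw_def)
    then show ?thesis
      by (intro exI[of _ "inv_into {..<?N} k c"]) (use inv_into_into[of c k "{..<?N}"] in \<open>auto simp: f_inv_into_f\<close>)
  qed
  show ?thesis
  proof (rule plays_isomorphic[OF _ _ Q _ plays le0])
    have "bij_betw e {..<?N} (colors P)" using embedded_inj[OF emb] e by (simp add: bij_betw_def)
    then show "bij_betw ?\<gamma> (colors Q) (colors P)"
      by (rule bij_betw_trans[OF bij_betw_inv_into[OF k(1)]])
    show "th (?\<gamma> a) (?\<gamma> b) = theta Q a b" if "a \<in> colors Q" "b \<in> colors Q" for a b
      using g[OF that(1)] g[OF that(2)] k(2) embedded_theta[OF emb] by metis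
    fix c assume "c \<in> colors Q"
    then obtain i where i: "i < ?N" "c = k i" "?\<gamma> c = e i" using g by blast
    have "c = k 0 \<longleftrightarrow> i = 0" using i k(1) by (auto simp: bij_betw_def dest: inj_onD)
    moreover have "(\<exists>a. child a (e i)) \<longleftrightarrow> i \<noteq> 0"
      using e(2) embedded_child[OF emb, of i] i(1) by (cases "i = 0") (auto simp: root_def)
    ultimately show "lam (?\<gamma> c) = (if c = k 0 then 1 else 0)"
      using lam_eq[of "e i"] embedded_in[OF emb i(1)] i(3) by simp
  qed
qed

end

text \<open>The last cover on a path from \<open>y\<close> down to \<open>x\<close> supplies the
  required step to an adjacent color. The comparability premise \<open>ac\<close> is the part that
  has to be proved for each poset.\<close>

lemma order_of_covers_heap:
  assumes "elems Q = S" "ord Q = order_of_covers S R" "R \<subseteq> S \<times> S" "color Q ` S \<subseteq> colors Q"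
    and na: "\<And>u v. (u, v) \<in> R \<Longrightarrow> theta Q (color Q u) (color Q v) = -1"
    and diag: "\<And>c. c \<in> colors Q \<Longrightarrow> theta Q c c = 2"
    and ac: "\<And>x y. x \<in> S \<Longrightarrow> y \<in> S \<Longrightarrow> theta Q (color Q x) (color Q y) = -1 \<Longrightarrow> (x, y) \<in> R\<^sup>* \<or> (y, x) \<in> R\<^sup>*"
  shows "heap_poset Q"
  unfolding heap_poset_def
proof (intro conjI allI impI ballI)
  show "trans (ord Q)" using assms(2) by (auto simp: order_of_covers_def trans_def)
next
  fix x y assume "less_in Q x y"
  then have xy: "x \<in> S" "y \<in> S" "(y, x) \<in> R\<^sup>*" "x \<noteq> y"
    using assms(1,2) by (auto simp: less_in_def order_of_covers_def)
  then obtain z where z: "(y, z) \<in> R\<^sup>*" "(z, x) \<in> R" by (metis rtranclE)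
  then have "z \<in> S" "theta Q (color Q z) (color Q x) = -1" using assms(3) na by auto
  moreover have "z \<noteq> x" using \<open>theta Q _ _ = -1\<close> diag[of "color Q x"] xy assms(4) by auto
  ultimately show "\<exists>z. less_in Q x z \<and> (z, y) \<in> ord Q \<and> theta Q (color Q z) (color Q x) = -1"
    using z xy assms(1,2) by (intro exI[of _ z]) (auto simp: less_in_def order_of_covers_def)
next
  fix x y assume "x \<in> elems Q" "y \<in> elems Q" "theta Q (color Q x) (color Q y) = -1"
  then show "comparable Q x y"
    using ac[of x y] assms(1,2) unfolding order_of_covers_def comparable_def by blast
qed (use assms(1,2,4) in \<open>auto simp: order_of_covers_def\<close>)


section \<open>The infinite families\<close>

lemma A_exterior_simps:
  "elems (A_exterior m n) = {1..m} \<times> {1..n + 1 - m}"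
  "colors (A_exterior m n) = {1..n}"
  "theta (A_exterior m n) = edge_theta {(s, s + 1) | s. 1 \<le> s \<and> s + 1 \<le> n}"
  "color (A_exterior m n) (a, b) = a + (n + 1 - m) - b"
  "((a, b), (a', b')) \<in> ord (A_exterior m n) \<longleftrightarrow>
     (a, b) \<in> {1..m} \<times> {1..n + 1 - m} \<and> (a', b') \<in> {1..m} \<times> {1..n + 1 - m} \<and> a \<le> a' \<and> b \<le> b'"
  by (auto simp: A_exterior_def)

lemma edge_theta_path:
  fixes n :: nat
  shows "edge_theta {(s, s + 1) | s. 1 \<le> s \<and> s + 1 \<le> n} a b =
     (if a = b then 2 else if 1 \<le> a \<and> a \<le> n \<and> 1 \<le> b \<and> b \<le> n \<and> (b = a + 1 \<or> a = b + 1) then -1 else 0)"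
  by (auto simp: edge_theta_def)

lemma A_exterior_heap:
  assumes M: "1 \<le> M" and K: "1 \<le> K"
  defines "n \<equiv> M + K - 1"
  shows "heap_poset (A_exterior M n)"
  unfolding heap_poset_def
proof (intro conjI allI impI ballI)
  let ?Q = "A_exterior M n"
  have nK: "n + 1 - M = K" and nM: "n + 1 = M + K" using M K by (auto simp: n_def)
  note Q = A_exterior_simps[where m = M and n = n, unfolded nK edge_theta_path]
  show "(x, x) \<in> ord ?Q" if "x \<in> elems ?Q" for x
    using that by (cases x) (auto simp: Q)
  show "trans (ord ?Q)" by (auto simp: trans_def Q)
  show "color ?Q ` elems ?Q \<subseteq> colors ?Q" using nM by (auto simp: Q)
  show "comparable ?Q x y"
    if "x \<in> elems ?Q" "y \<in> elems ?Q" "theta ?Q (color ?Q x) (color ?Q y) = -1" for x y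
  proof -
    obtain a b a' b' where xy: "x = (a, b)" "y = (a', b')" by (cases x; cases y)
    have l: "a \<in> {1..M}" "b \<in> {1..K}" "a' \<in> {1..M}" "b' \<in> {1..K}" using that(1,2) xy by (auto simp: Q)
    have "a + K - b = a' + K - b' + 1 \<or> a' + K - b' = a + K - b + 1"
      using that(3) unfolding xy Q by (auto split: if_splits)
    then have "a + b' = a' + b + 1 \<or> a' + b = a + b' + 1" using l by auto
    then have "a \<le> a' \<and> b \<le> b' \<or> a' \<le> a \<and> b' \<le> b" by linarith
    then show ?thesis using l unfolding xy comparable_def Q by simp
  qed
  fix x y assume "less_in ?Q x y"
  moreover obtain a b a' b' where xy: "x = (a, b)" "y = (a', b')" by (cases x; cases y)
  ultimately have l: "1 \<le> a" "1 \<le> b" "a \<le> a'" "b \<le> b'" "a' \<le> M" "b' \<le> K" "a < a' \<or> b < b'"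
    by (auto simp: less_in_def Q)
  show "\<exists>z. less_in ?Q x z \<and> (z, y) \<in> ord ?Q \<and> theta ?Q (color ?Q z) (color ?Q x) = -1"
  proof (cases "a < a'")
    case True
    have "theta ?Q (color ?Q (a + 1, b)) (color ?Q x) = -1"
    proof -
      have "a + 1 + K - b = a + K - b + 1" "1 \<le> a + K - b" "a + K - b + 1 \<le> n"
        using l nM True by linarith+
      then show ?thesis unfolding xy Q by simp
    qed
    moreover have "less_in ?Q x (a + 1, b)" "((a + 1, b), y) \<in> ord ?Q"
      using l True unfolding xy less_in_def Q by auto
    ultimately show ?thesis by blast
  next
    case False
    have "theta ?Q (color ?Q (a, b + 1)) (color ?Q x) = -1"
    proof -
      have "a + K - b = a + K - (b + 1) + 1" "1 \<le> a + K - (b + 1)" "a + K - b \<le> n"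
        using l nM False by linarith+
      then show ?thesis unfolding xy Q by simp
    qed
    moreover have "less_in ?Q x (a, b + 1)" "((a, b + 1), y) \<in> ord ?Q"
      using l False unfolding xy less_in_def Q by auto
    ultimately show ?thesis by blast
  qed
qed

text \<open>The rectangle is played from its maximum \<open>(M, K)\<close>, row after row downwards;
  \<open>S a b\<close> is the part played once row \<open>a\<close> has been done above column
  \<open>b\<close>.\<close>

lemma A_exterior_plays:
  assumes M: "1 \<le> M" and K: "1 \<le> K"
  defines "n \<equiv> M + K - 1"
  shows "plays (A_exterior M n) (\<lambda>c. if c = M then 1 else 0) (elems (A_exterior M n))
    (\<lambda>c. if c = K then -1 else 0)"
proof -
  let ?Q = "A_exterior M n" and ?\<omega> = "\<lambda>c. if c = M then 1 else 0 :: int"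
  have nK: "n + 1 - M = K" and nM: "n + 1 = M + K" using M K by (auto simp: n_def)
  note Q = A_exterior_simps[where m = M and n = n, unfolded nK edge_theta_path]
  let ?d = "\<lambda>i j :: nat. if i = j then 1 else 0 :: int"
  define S where "S a b = {(x, y). x \<in> {1..M} \<and> y \<in> {1..K} \<and> (a < x \<or> x = a \<and> b < y)}" for a b
  \<comment> \<open>The two positive terms are the colors of the next elements \<open>(a, b)\<close>
    and \<open>(a - 1, K)\<close> at the corners of the played part. Before and after a full row a
    positive term cancels a negative one, and the indices 0 and \<open>M + K\<close> lie outside the
    diagram.\<close>
  define \<mu> where "\<mu> a b c = ?d (a - 1) c - ?d (a + K - b - 1) c + ?d (a + K - b) c - ?d (a + K) c" for a b c
  have row: "plays ?Q ?\<omega> (S a b) (\<mu> a b)"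
    if "plays ?Q ?\<omega> (S a K) (\<mu> a K)" "1 \<le> a" "a \<le> M" "b \<le> K" for a b
    using \<open>b \<le> K\<close>
  proof (induction rule: inc_induct)
    case base
    show ?case by fact
  next
    case (step b)
    have ab: "a + K - Suc b + 1 = a + K - b" using step.hyps by simp
    show ?case
    proof (rule plays.step[OF step.IH, of "(a, Suc b)"])
      show "(a, Suc b) \<in> elems ?Q" using that step.hyps by (simp add: Q)
      show "(a, Suc b) \<notin> S a (Suc b)" by (simp add: S_def)
      show "S a b = insert (a, Suc b) (S a (Suc b))" using that step.hyps by (auto simp: S_def)
      show "z \<in> S a (Suc b)" if "less_in ?Q (a, Suc b) z" for z
        using that by (cases z) (auto simp: less_in_def Q S_def)
      show "\<mu> a (Suc b) (color ?Q (a, Suc b)) = 1"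
        using that step.hyps by (auto simp: Q \<mu>_def)
      show "\<mu> a b c = \<mu> a (Suc b) c - theta ?Q (color ?Q (a, Suc b)) c" if "c \<in> colors ?Q" for c
        using that \<open>1 \<le> a\<close> \<open>a \<le> M\<close> step.hyps nM by (auto simp: Q \<mu>_def)
    qed
  qed
  have rows: "plays ?Q ?\<omega> (S a K) (\<mu> a K)" if "1 \<le> a" "a \<le> M" for a
    using \<open>a \<le> M\<close>
  proof (induction rule: inc_induct)
    case base
    have "S M K = {}" by (auto simp: S_def)
    moreover have "plays ?Q ?\<omega> {} (\<mu> M K)"
      by (rule plays.start) (use M K nM in \<open>auto simp: Q \<mu>_def\<close>)
    ultimately show ?case by simp
  next
    case (step a')
    have "S (Suc a') 0 = S a' K" by (auto simp: S_def)
    moreover have "\<mu> (Suc a') 0 = \<mu> a' K" using step.hyps that by (auto simp: \<mu>_def fun_eq_iff)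
    ultimately show ?case using row[OF step.IH, of 0] step.hyps by simp
  qed
  have "plays ?Q ?\<omega> (S 1 0) (\<mu> 1 0)" using row[OF rows[of 1], of 0] M by simp
  moreover have "S 1 0 = elems ?Q" by (auto simp: S_def Q)
  moreover have "\<mu> 1 0 = (\<lambda>c. ?d 0 c - ?d K c)" by (auto simp: \<mu>_def fun_eq_iff)
  ultimately have "plays ?Q ?\<omega> (elems ?Q) (\<lambda>c. ?d 0 c - ?d K c)" by simp
  then show ?thesis by (rule plays_cong) (auto simp: Q)
qed


text \<open>For an order generated by covers only the covers of the new element have to be
  inspected, because the played set is already closed upwards.\<close>

lemma plays_step_covers:
  assumes Q: "elems Q = S" "ord Q = order_of_covers S R" "R \<subseteq> S \<times> S"
    and p: "plays Q \<omega> A \<mu>" and y: "y \<in> S" "y \<notin> A" and up: "\<And>u. (u, y) \<in> R \<Longrightarrow> u \<in> A"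
    and \<mu>: "\<mu> (color Q y) = 1" "A' = insert y A"
      "\<And>c. c \<in> colors Q \<Longrightarrow> \<nu> c = \<mu> c - theta Q (color Q y) c"
  shows "plays Q \<omega> A' \<nu>"
proof (rule plays.step[OF p _ y(2) _ \<mu>])
  show "y \<in> elems Q" using Q y by simp
  fix z assume "less_in Q y z"
  then have z: "(z, y) \<in> R\<^sup>*" "z \<noteq> y" "z \<in> S" using Q by (auto simp: less_in_def order_of_covers_def)
  then obtain u where u: "(z, u) \<in> R\<^sup>*" "(u, y) \<in> R" by (metis rtranclE)
  then have "u \<in> A" "u \<in> S" using up Q(3) by auto
  then show "z \<in> A"
    using plays_upset[OF p] u z Q by (cases "z = u") (auto simp: less_in_def order_of_covers_def)
qed

section \<open>Type D standard: two chains joined by a diamond\<close>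

lemma D_standard_simps:
  fixes s
  defines "n \<equiv> s + 3"
  shows "elems (D_standard n) = X ` {1..s + 1} \<union> {Y, Z} \<union> X' ` {1..s + 1}"
    "ord (D_standard n) = order_of_covers (elems (D_standard n)) (D_std_covers n)"
    "colors (D_standard n) = {1..s + 3}"
    "color (D_standard n) (X j) = j" "color (D_standard n) (X' j) = j"
    "color (D_standard n) Y = s + 2" "color (D_standard n) Z = s + 3"
    "theta (D_standard n) a b = (if a = b then 2
       else if 1 \<le> a \<and> a \<le> s + 1 \<and> b = a + 1 \<or> 1 \<le> b \<and> b \<le> s + 1 \<and> a = b + 1
         \<or> a = s + 1 \<and> b = s + 3 \<or> b = s + 1 \<and> a = s + 3 then -1 else 0)"
    "(u, X j) \<in> D_std_covers n \<longleftrightarrow> (\<exists>i. 1 \<le> i \<and> i \<le> s \<and> u = X i \<and> j = i + 1)"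
    "(u, Y) \<in> D_std_covers n \<longleftrightarrow> u = X (s + 1)"
    "(u, Z) \<in> D_std_covers n \<longleftrightarrow> u = X (s + 1)"
    "(u, X' j) \<in> D_std_covers n \<longleftrightarrow> 1 \<le> j \<and> j \<le> s \<and> u = X' (j + 1) \<or> j = s + 1 \<and> (u = Y \<or> u = Z)"
  by (auto simp: n_def D_standard_def D_std_elems_def D_std_covers_def edge_theta_def eval_nat_numeral)

lemma D_standard_covers_subset:
  "D_std_covers (s + 3) \<subseteq> elems (D_standard (s + 3)) \<times> elems (D_standard (s + 3))"
  by (auto simp: D_standard_simps D_std_covers_def)

lemma D_standard_heap: "heap_poset (D_standard (s + 3))"
proof (rule order_of_covers_heap[OF refl D_standard_simps(2) D_standard_covers_subset])
  let ?Q = "D_standard (s + 3)" and ?R = "D_std_covers (s + 3)"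
  note Q = D_standard_simps
  show "color ?Q ` elems ?Q \<subseteq> colors ?Q" by (auto simp: Q)
  show "theta ?Q (color ?Q u) (color ?Q v) = -1" if "(u, v) \<in> ?R" for u v
    using that by (cases v) (auto simp: Q)
  show "theta ?Q c c = 2" for c by (simp add: Q)
  have XX: "(X a, X b) \<in> ?R\<^sup>*" if "1 \<le> a" "a \<le> b" "b \<le> s + 1" for a b
    using \<open>a \<le> b\<close> \<open>b \<le> s + 1\<close>
  proof (induction rule: dec_induct)
    case (step b)
    then have "(X b, X (Suc b)) \<in> ?R" using that by (auto simp: Q)
    then show ?case using step by (auto intro: rtrancl_into_rtrancl)
  qed auto
  have X'X': "(X' b, X' a) \<in> ?R\<^sup>*" if "1 \<le> a" "a \<le> b" "b \<le> s + 1" for a b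
    using \<open>a \<le> b\<close> \<open>b \<le> s + 1\<close>
  proof (induction rule: dec_induct)
    case (step b)
    then have "(X' (Suc b), X' b) \<in> ?R" using that by (auto simp: Q)
    then show ?case using step by (auto intro: converse_rtrancl_into_rtrancl)
  qed auto
  have XY: "(X a, Y) \<in> ?R\<^sup>*" "(X a, Z) \<in> ?R\<^sup>*" if "1 \<le> a" "a \<le> s + 1" for a
    using XX[OF that(1,2)] by (auto simp: Q intro: rtrancl_into_rtrancl)
  have YX': "(Y, X' a) \<in> ?R\<^sup>*" "(Z, X' a) \<in> ?R\<^sup>*" if "1 \<le> a" "a \<le> s + 1" for a
    using X'X'[OF that(1,2)]
    by (auto simp: Q intro: converse_rtrancl_into_rtrancl[where b = "X' (Suc s)"])
  have XX': "(X a, X' b) \<in> ?R\<^sup>*" if "1 \<le> a" "a \<le> s + 1" "1 \<le> b" "b \<le> s + 1" for a b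
    using XY(1)[OF that(1,2)] YX'(1)[OF that(3,4)] by (rule rtrancl_trans)
  fix x y assume xy: "x \<in> elems ?Q" "y \<in> elems ?Q" "theta ?Q (color ?Q x) (color ?Q y) = -1"
  then show "(x, y) \<in> ?R\<^sup>* \<or> (y, x) \<in> ?R\<^sup>*"
    using XX X'X' XY YX' XX' linear by (auto simp: Q(1) simp del: One_nat_def) (auto simp: Q split: if_splits)
qed

text \<open>A single 1 travels along the colors 1 to \<open>s + 1\<close>, splits into the colors of
  \<open>Y\<close> and \<open>Z\<close>, merges at \<open>s + 1\<close> and travels back. It leaves
  through index 0, which is no color.\<close>

lemma D_standard_plays:
  "plays (D_standard (s + 3)) (\<lambda>c. if c = 1 then 1 else 0) (elems (D_standard (s + 3)))
    (\<lambda>c. if c = 1 then -1 else 0)"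
proof -
  let ?Q = "D_standard (s + 3)" and ?\<omega> = "\<lambda>c :: nat. if c = 1 then 1 else 0 :: int"
  note Q = D_standard_simps
  note step = plays_step_covers[OF refl D_standard_simps(2) D_standard_covers_subset]
  let ?d = "\<lambda>i j :: nat. if i = j then 1 else 0 :: int"
  have up: "plays ?Q ?\<omega> (X ` {1..j}) (\<lambda>c. ?d (j + 1) c - ?d j c)" if "j \<le> s" for j
    using that
  proof (induction j)
    case 0
    show ?case by (simp, rule plays.start) (auto simp: Q)
  next
    case (Suc j)
    show ?case
      by (rule step[OF Suc.IH, where y = "X (Suc j)"]) (use Suc.prems in \<open>auto simp: Q atLeastAtMostSuc_conv\<close>)
  qed
  have "plays ?Q ?\<omega> (X ` {1..s + 1}) (\<lambda>c. ?d (s + 2) c + ?d (s + 3) c - ?d (s + 1) c)"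
    by (rule step[OF up[of s], where y = "X (s + 1)"]) (auto simp: Q atLeastAtMostSuc_conv)
  then have "plays ?Q ?\<omega> (X ` {1..s + 1} \<union> {Y}) (\<lambda>c. ?d (s + 3) c - ?d (s + 2) c)"
    by (rule step[where y = Y]) (auto simp: Q)
  then have "plays ?Q ?\<omega> (X ` {1..s + 1} \<union> {Y, Z}) (\<lambda>c. ?d (s + 1) c - ?d (s + 2) c - ?d (s + 3) c)"
    by (rule step[where y = Z]) (auto simp: Q)
  then have "plays ?Q ?\<omega> (X ` {1..s + 1} \<union> {Y, Z} \<union> X' ` {s + 1..s + 1}) (\<lambda>c. ?d s c - ?d (s + 1) c)"
    by (rule step[where y = "X' (s + 1)"]) (auto simp: Q)
  then have bottom: "plays ?Q ?\<omega> (X ` {1..s + 1} \<union> {Y, Z} \<union> X' ` {Suc s..s + 1}) (\<lambda>c. ?d s c - ?d (Suc s) c)"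
    by simp
  have "plays ?Q ?\<omega> (X ` {1..s + 1} \<union> {Y, Z} \<union> X' ` {Suc j..s + 1}) (\<lambda>c. ?d j c - ?d (Suc j) c)"
    if "j \<le> s" for j
    using that
  proof (induction rule: inc_induct)
    case base
    show ?case by (rule bottom)
  next
    case (step j)
    have "{Suc j..s + 1} = insert (Suc j) {Suc (Suc j)..s + 1}" using step.hyps by auto
    then show ?case
      by (intro plays_step_covers[OF refl D_standard_simps(2) D_standard_covers_subset step.IH, where y = "X' (Suc j)"])
        (use step.hyps in \<open>auto simp: Q\<close>)
  qed
  from this[of 0] have "plays ?Q ?\<omega> (elems ?Q) (\<lambda>c. ?d 0 c - ?d 1 c)" by (simp add: Q)
  then show ?thesis by (rule plays_cong) (auto simp: Q)
qed


section \<open>Type D spin: the shifted staircase\<close>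

lemma D_spin_simps:
  fixes q
  defines "n \<equiv> q + 3"
  shows "elems (D_spin n) = {(u, v). u \<le> v \<and> v \<le> q + 1}"
    "((u, v), (u', v')) \<in> ord (D_spin n) \<longleftrightarrow>
       u \<le> v \<and> v \<le> q + 1 \<and> u' \<le> v' \<and> v' \<le> q + 1 \<and> u' \<le> u \<and> v' \<le> v"
    "colors (D_spin n) = {C0, C0'} \<union> C ` {1..q + 1}"
    "color (D_spin n) (u, v) = (if u < v then C (v - u) else if even u then C0 else C0')"
    "theta (D_spin n) C0 C0 = 2" "theta (D_spin n) C0' C0' = 2"
    "theta (D_spin n) C0 C0' = 0" "theta (D_spin n) C0' C0 = 0"
    "theta (D_spin n) C0 (C j) = (if j = 1 then -1 else 0)"
    "theta (D_spin n) C0' (C j) = (if j = 1 then -1 else 0)"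
    "theta (D_spin n) (C j) C0 = (if j = 1 then -1 else 0)"
    "theta (D_spin n) (C j) C0' = (if j = 1 then -1 else 0)"
    "theta (D_spin n) (C i) (C j) = (if i = j then 2
       else if 1 \<le> i \<and> i \<le> q \<and> j = i + 1 \<or> 1 \<le> j \<and> j \<le> q \<and> i = j + 1 then -1 else 0)"
  by (auto simp: n_def D_spin_def D_spin_elems_def edge_theta_def)

lemma D_spin_heap: "heap_poset (D_spin (q + 3))"
  unfolding heap_poset_def
proof (intro conjI allI impI ballI)
  let ?Q = "D_spin (q + 3)"
  note Q = D_spin_simps
  show "(x, x) \<in> ord ?Q" if "x \<in> elems ?Q" for x
    using that by (cases x) (auto simp: Q)
  show "trans (ord ?Q)"
    unfolding trans_def by (clarsimp simp: Q)
  show "color ?Q ` elems ?Q \<subseteq> colors ?Q"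
  proof (rule image_subsetI)
    fix x assume "x \<in> elems ?Q"
    then show "color ?Q x \<in> colors ?Q" by (cases x; cases "fst x < snd x") (auto simp: Q intro!: imageI)
  qed
  show "comparable ?Q x y"
    if "x \<in> elems ?Q" "y \<in> elems ?Q" "theta ?Q (color ?Q x) (color ?Q y) = -1" for x y
  proof -
    obtain u v u' v' where xy: "x = (u, v)" "y = (u', v')" by (cases x; cases y)
    have l: "u \<le> v" "v \<le> q + 1" "u' \<le> v'" "v' \<le> q + 1" using that(1,2) xy by (auto simp: Q)
    have "v - u = v' - u' + 1 \<or> v' - u' = v - u + 1"
      using that(3) l unfolding xy Q by (auto simp: Q split: if_splits)
    then have "v + u' = v' + u + 1 \<or> v' + u = v + u' + 1" using l by linarith
    then have "u \<le> u' \<and> v \<le> v' \<or> u' \<le> u \<and> v' \<le> v" by linarith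
    then show ?thesis using l unfolding xy comparable_def Q by auto
  qed
  fix x y assume "less_in ?Q x y"
  moreover obtain u v u' v' where xy: "x = (u, v)" "y = (u', v')" by (cases x; cases y)
  ultimately have l: "u \<le> v" "v \<le> q + 1" "u' \<le> v'" "v' \<le> q + 1" "u' \<le> u" "v' \<le> v" "u' < u \<or> v' < v"
    by (auto simp: less_in_def Q)
  show "\<exists>z. less_in ?Q x z \<and> (z, y) \<in> ord ?Q \<and> theta ?Q (color ?Q z) (color ?Q x) = -1"
  proof (cases "u' < u")
    case True
    then obtain w where w: "u = Suc w" by (cases u) auto
    have "v - w = Suc (v - u)" "v - u \<le> q" using w l by linarith+
    then have "theta ?Q (color ?Q (w, v)) (color ?Q x) = -1"
      using w l unfolding xy Q by (auto simp: Q)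
    moreover have "less_in ?Q x (w, v)" "((w, v), y) \<in> ord ?Q"
      using l w True unfolding xy less_in_def Q by auto
    ultimately show ?thesis by blast
  next
    case False
    then obtain w where w: "v = Suc w" using l by (cases v) auto
    have "v - u = Suc (w - u)" "w - u \<le> q" "u \<le> w" using w l False by linarith+
    then have "theta ?Q (color ?Q (u, w)) (color ?Q x) = -1"
      using w l unfolding xy Q by (auto simp: Q)
    moreover have "less_in ?Q x (u, w)" "((u, w), y) \<in> ord ?Q"
      using l w False unfolding xy less_in_def Q by auto
    ultimately show ?thesis by blast
  qed
qed

text \<open>The staircase is played in rows: for fixed \<open>u\<close> the second coordinate runs
  from the diagonal to \<open>q + 1\<close>. The diagonal elements use the two spin nodes
  alternately.\<close>

lemma D_spin_plays:
  "\<exists>\<mu>. plays (D_spin (q + 3)) (\<lambda>c. if c = C0 then 1 else 0) (elems (D_spin (q + 3))) \<mu> \<and> (\<forall>c. \<mu> c \<le> 0)"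
proof -
  let ?Q = "D_spin (q + 3)" and ?\<omega> = "\<lambda>c. if c = C0 then 1 else 0 :: int"
  note Q = D_spin_simps
  let ?d = "\<lambda>i j :: nat. if i = j then 1 else 0 :: int"
  define spin where "spin u = (if even u then C0 else C0')" for u :: nat
  define S where "S u v = {(x, y). x \<le> y \<and> y \<le> q + 1 \<and> (x < u \<or> x = u \<and> y < v)}" for u v
  \<comment> \<open>The three spin cases are: row \<open>u\<close> about to start, its diagonal
    element just played, and, after its element of color \<open>C 1\<close>, the other spin node
    ready for the next row. Index \<open>q + 2 - u\<close> is the -1 left by the end of the previous
    row, and for \<open>u = 0\<close> it is no node. The entry at \<open>j = 0\<close> is set to 0
    because \<open>C 0\<close> is no node.\<close>
  define \<mu> where "\<mu> u v c = (case c of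
      C j \<Rightarrow> (if j = 0 then 0 else ?d (v - u) j - ?d (v - u - 1) j - ?d (q + 2 - u) j)
    | _ \<Rightarrow> (if v = u then if spin u = c then 1 else 0
        else if v = u + 1 then if spin u = c then -1 else 0
        else if spin (u + 1) = c then 1 else 0))" for u v c
  have row: "plays ?Q ?\<omega> (S u v) (\<mu> u v)"
    if "plays ?Q ?\<omega> (S u u) (\<mu> u u)" "u \<le> v" "v \<le> q + 2" for u v
    using \<open>u \<le> v\<close> \<open>v \<le> q + 2\<close>
  proof (induction rule: dec_induct)
    case base
    show ?case by fact
  next
    case (step v)
    then have IH: "plays ?Q ?\<omega> (S u v) (\<mu> u v)" by simp
    show ?case
    proof (rule plays.step[OF IH, of "(u, v)"])
      show "(u, v) \<in> elems ?Q" using step by (simp add: Q)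
      show "(u, v) \<notin> S u v" by (simp add: S_def)
      show "S u (Suc v) = insert (u, v) (S u v)" using step by (auto simp: S_def)
      show "z \<in> S u v" if "less_in ?Q (u, v) z" for z
        using that by (cases z) (auto simp: less_in_def Q S_def)
      show "\<mu> u v (color ?Q (u, v)) = 1"
        using step by (auto simp: Q \<mu>_def spin_def)
      show "\<mu> u (Suc v) c = \<mu> u v c - theta ?Q (color ?Q (u, v)) c" if "c \<in> colors ?Q" for c
      proof -
        have "v = u \<or> v = u + 1 \<or> (\<exists>w. v = u + 2 + w)" using step.hyps by presburger
        then consider "v = u" | "v = u + 1" | w where "v = u + 2 + w" by blast
        then show ?thesis
          by cases (use that step in \<open>auto simp: Q \<mu>_def spin_def\<close>)
      qed
    qed
  qed
  have rows: "plays ?Q ?\<omega> (S u u) (\<mu> u u)" if "u \<le> q + 1" for u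
    using that
  proof (induction u)
    case 0
    have "S 0 0 = {}" by (auto simp: S_def)
    moreover have "plays ?Q ?\<omega> {} (\<mu> 0 0)"
      by (rule plays.start) (auto simp: Q \<mu>_def spin_def)
    ultimately show ?case by simp
  next
    case (Suc u)
    have "S u (q + 2) = S (Suc u) (Suc u)" by (auto simp: S_def)
    moreover have "\<mu> u (q + 2) = \<mu> (Suc u) (Suc u)"
      using Suc.prems by (auto simp: \<mu>_def fun_eq_iff spin_def split: D_spin_node.splits)
    ultimately show ?case using row[OF Suc.IH, of "q + 2"] Suc.prems by simp
  qed
  have "plays ?Q ?\<omega> (S (q + 1) (q + 2)) (\<mu> (q + 1) (q + 2))"
    using row[OF rows[of "q + 1"], of "q + 2"] by simp
  moreover have "S (q + 1) (q + 2) = elems ?Q" by (auto simp: S_def Q)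
  \<comment> \<open>In the last position the indices \<open>v - u\<close> and
    \<open>q + 2 - u\<close> are both 1, so the only positive term cancels.\<close>
  moreover have "\<mu> (q + 1) (q + 2) c \<le> 0" for c by (auto simp: \<mu>_def split: D_spin_node.splits)
  ultimately show ?thesis by metis
qed


section \<open>The exceptional types\<close>

text \<open>The table records the elements played so far together with the elements above each of
  them, so that comparability can be read off without computing a transitive closure.\<close>

fun legal_list :: "('b \<times> 'b) list \<Rightarrow> ('b \<Rightarrow> 'd) \<Rightarrow> ('d \<Rightarrow> 'd \<Rightarrow> int) \<Rightarrow>
    'b list \<Rightarrow> ('b \<times> 'b list) list \<Rightarrow> ('d \<times> int) list \<Rightarrow> bool" where
  "legal_list R f t [] tbl ws \<longleftrightarrow> list_all (\<lambda>(_, k). k \<le> 0) ws"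
| "legal_list R f t (y # ys) tbl ws \<longleftrightarrow>
     (let above = y # concat (map (\<lambda>(z, as). if (z, y) \<in> set R then as else []) tbl) in
       y \<notin> set (map fst tbl) \<and>
       list_all (\<lambda>(u, v). v = y \<longrightarrow> u \<in> set (map fst tbl)) R \<and>
       list_all (\<lambda>(z, _). t (f z) (f y) = -1 \<longrightarrow> z \<in> set above) tbl \<and>
       (f y, 1) \<in> set ws \<and>
       legal_list R f t ys ((y, remdups above) # tbl) (map (\<lambda>(c, k). (c, k - t (f y) c)) ws))"

text \<open>Comparability is tested for a new element against the earlier ones only; symmetry of
  \<open>t\<close> covers the reversed pairs. Of the table only soundness is required: whatever is
  recorded above an element reaches it through covers.\<close>

lemma legal_list_sound:
  assumes Q: "elems Q = S" "ord Q = order_of_covers S (set R)" "set R \<subseteq> S \<times> S" "color Q = f" "theta Q = t"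
    and sym: "\<And>a b. t a b = t b a"
  shows "legal_list R f t ys tbl ws \<Longrightarrow> \<forall>(c, k)\<in>set ws. c \<in> colors Q \<and> k = \<mu> c \<Longrightarrow> plays Q \<omega> (set (map fst tbl)) \<mu> \<Longrightarrow> set ys \<subseteq> S \<Longrightarrow>
    (\<forall>(z, as)\<in>set tbl. \<forall>a\<in>set as. (a, z) \<in> (set R)\<^sup>*) \<Longrightarrow>
    (\<forall>x\<in>set (map fst tbl). \<forall>y\<in>set (map fst tbl). t (f x) (f y) = -1 \<longrightarrow>
      (x, y) \<in> (set R)\<^sup>* \<or> (y, x) \<in> (set R)\<^sup>*) \<Longrightarrow>
    (\<exists>\<nu>. plays Q \<omega> (set ys \<union> set (map fst tbl)) \<nu> \<and> (\<forall>c\<in>fst ` set ws. \<nu> c \<le> 0)) \<and>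
    (\<forall>x\<in>set ys \<union> set (map fst tbl). \<forall>y\<in>set ys \<union> set (map fst tbl). t (f x) (f y) = -1 \<longrightarrow>
      (x, y) \<in> (set R)\<^sup>* \<or> (y, x) \<in> (set R)\<^sup>*)"
proof (induction ys arbitrary: tbl ws \<mu>)
  case Nil
  have "\<mu> c \<le> 0" if "(c, k) \<in> set ws" for c k
    using Nil.prems(1,2) that by (auto simp: list_all_iff)
  then have "\<forall>c\<in>fst ` set ws. \<mu> c \<le> 0" by auto
  then show ?case using Nil.prems(3,6) by auto
next
  case (Cons y ys)
  define above where "above = y # concat (map (\<lambda>(z, as). if (z, y) \<in> set R then as else []) tbl)"
  let ?A = "set (map fst tbl)" and ?tbl = "(y, remdups above) # tbl"
  have new: "y \<notin> ?A" and cov: "\<And>u. (u, y) \<in> set R \<Longrightarrow> u \<in> ?A"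
    and cmp: "\<And>z. z \<in> ?A \<Longrightarrow> t (f z) (f y) = -1 \<Longrightarrow> z \<in> set above"
    and one: "\<mu> (f y) = 1"
    and rest: "legal_list R f t ys ?tbl (map (\<lambda>(c, k). (c, k - t (f y) c)) ws)"
    using Cons.prems(1,2) by (auto simp: Let_def list_all_iff above_def[symmetric])
  have anc: "(a, y) \<in> (set R)\<^sup>*" if a: "a \<in> set above" for a
  proof (cases "a = y")
    case False
    then obtain z as where "(z, as) \<in> set tbl" "(z, y) \<in> set R" "a \<in> set as"
      using a by (auto simp: above_def split: if_splits)
    then show ?thesis using Cons.prems(5) by (blast intro: rtrancl_into_rtrancl)
  qed simp
  have p: "plays Q \<omega> (set (map fst ?tbl)) (\<lambda>c. \<mu> c - t (f y) c)"
    by (rule plays_step_covers[OF Q(1-3) Cons.prems(3) _ new cov])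
      (use Q one Cons.prems(4) in auto)
  let ?ws = "map (\<lambda>(c, k). (c, k - t (f y) c)) ws"
  have "(\<exists>\<nu>. plays Q \<omega> (set ys \<union> set (map fst ?tbl)) \<nu> \<and> (\<forall>c\<in>fst ` set ?ws. \<nu> c \<le> 0)) \<and>
    (\<forall>x\<in>set ys \<union> set (map fst ?tbl). \<forall>y\<in>set ys \<union> set (map fst ?tbl). t (f x) (f y) = -1 \<longrightarrow>
      (x, y) \<in> (set R)\<^sup>* \<or> (y, x) \<in> (set R)\<^sup>*)"
  proof (rule Cons.IH[OF rest _ p])
    show "\<forall>(z, as)\<in>set ?tbl. \<forall>a\<in>set as. (a, z) \<in> (set R)\<^sup>*" using anc Cons.prems(5) by auto
    have "(z, y) \<in> (set R)\<^sup>*" if "z \<in> ?A" "t (f z) (f y) = -1 \<or> t (f y) (f z) = -1" for z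
      using anc cmp that sym[of "f y" "f z"] by auto
    then show "\<forall>x\<in>set (map fst ?tbl). \<forall>y\<in>set (map fst ?tbl). t (f x) (f y) = -1 \<longrightarrow>
        (x, y) \<in> (set R)\<^sup>* \<or> (y, x) \<in> (set R)\<^sup>*"
      using Cons.prems(6) by auto
  qed (use Cons.prems(2,4) in auto)
  moreover have ws: "fst ` set ?ws = fst ` set ws" by force
  ultimately show ?case unfolding ws by simp
qed

text \<open>One evaluation of \<open>legal_list\<close> supplies both the comparabilities for
  \<open>heap_poset\<close> and the complete play.\<close>

lemma legal_list_plays:
  assumes Q: "elems Q = set ys" "ord Q = order_of_covers (set ys) (set R)"
      "color Q = f" "theta Q = edge_theta E" "colors Q = set cs"
    and col: "f ` set ys \<subseteq> set cs"
    and na: "list_all (\<lambda>(u, v). u \<in> set ys \<and> v \<in> set ys \<and> theta Q (f u) (f v) = -1) R"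
    and ok: "legal_list R f (theta Q) ys [] (map (\<lambda>c. (c, \<omega> c)) cs)"
  shows "heap_poset Q" "\<exists>\<mu>. plays Q \<omega> (elems Q) \<mu> \<and> (\<forall>c\<in>colors Q. \<mu> c \<le> 0)"
proof -
  have sub: "set R \<subseteq> set ys \<times> set ys" using na by (auto simp: list_all_iff)
  have sym: "theta Q a b = theta Q b a" for a b unfolding Q(4) edge_theta_def by auto
  have "plays Q \<omega> {} \<omega>" by (rule plays.start) simp
  then have s: "(\<exists>\<nu>. plays Q \<omega> (set ys) \<nu> \<and> (\<forall>c\<in>set cs. \<nu> c \<le> 0)) \<and>
    (\<forall>x\<in>set ys. \<forall>y\<in>set ys. theta Q (f x) (f y) = -1 \<longrightarrow> (x, y) \<in> (set R)\<^sup>* \<or> (y, x) \<in> (set R)\<^sup>*)"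
    using legal_list_sound[OF Q(1,2) sub Q(3) refl sym ok, of \<omega> \<omega>] Q(5) by (auto simp: image_image)
  then show "\<exists>\<mu>. plays Q \<omega> (elems Q) \<mu> \<and> (\<forall>c\<in>colors Q. \<mu> c \<le> 0)" using Q by simp
  show "heap_poset Q"
  proof (rule order_of_covers_heap[OF Q(1,2) sub])
    show "color Q ` set ys \<subseteq> colors Q" using col Q by simp
    show "theta Q c c = 2" for c by (simp add: Q(4) edge_theta_def)
    show "theta Q (color Q u) (color Q v) = -1" if "(u, v) \<in> set R" for u v
      using na that Q(3) by (auto simp: list_all_iff)
  qed (use s Q(3) in auto)
qed

section \<open>Type E6: a linear extension read from the top, with its evaluation\<close>

definition E6_list :: "(E_node \<times> nat) list" where
  "E6_list =
     [(Na, 1), (Nb, 1), (Nc, 1), (Nd, 1), (Nf, 1), (Ne, 1), (Nc, 2), (Nd, 2), (Nb, 2), (Nc, 3),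
      (Na, 2), (Nb, 3), (Nf, 2), (Nc, 4), (Nd, 3), (Ne, 2)]"

definition E6_cover_list :: "((E_node \<times> nat) \<times> (E_node \<times> nat)) list" where
  "E6_cover_list =
     [((Na, 1), (Nb, 1)), ((Nb, 1), (Nc, 1)), ((Nc, 1), (Nd, 1)), ((Nc, 1), (Nf, 1)), ((Nd, 1),
      (Ne, 1)), ((Nd, 1), (Nc, 2)), ((Nf, 1), (Nc, 2)), ((Ne, 1), (Nd, 2)), ((Nc, 2), (Nd, 2)),
      ((Nc, 2), (Nb, 2)), ((Nd, 2), (Nc, 3)), ((Nb, 2), (Nc, 3)), ((Nb, 2), (Na, 2)), ((Nc, 3),
      (Nb, 3)), ((Nc, 3), (Nf, 2)), ((Na, 2), (Nb, 3)), ((Nb, 3), (Nc, 4)), ((Nf, 2), (Nc, 4)),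
      ((Nc, 4), (Nd, 3)), ((Nd, 3), (Ne, 2))]"

lemma E6_elems_list: "E6_elems = set E6_list"
  by code_simp

lemma E6_covers_list: "E6_covers = set E6_cover_list"
  by (simp only: E6_covers_def E6_cover_list_def list.set)

lemma E6_simps:
  "elems E6 = set E6_list" "ord E6 = order_of_covers (set E6_list) (set E6_cover_list)"
  "color E6 = fst" "theta E6 = edge_theta {(Na, Nb), (Nb, Nc), (Nc, Nd), (Nd, Ne), (Nc, Nf)}" "colors E6 = set [Na, Nb, Nc, Nd, Ne, Nf]"
  by (simp_all add: E6_def E6_elems_list E6_covers_list)

lemma E6_legal: "legal_list E6_cover_list fst (edge_theta {(Na, Nb), (Nb, Nc), (Nc, Nd), (Nd, Ne), (Nc, Nf)})
    E6_list [] (map (\<lambda>c. (c, if c = Na then 1 else 0)) [Na, Nb, Nc, Nd, Ne, Nf])"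
  by code_simp

lemma E6_cover_list_wf:
  "fst ` set E6_list \<subseteq> set [Na, Nb, Nc, Nd, Ne, Nf]"
  "list_all (\<lambda>(u, v). u \<in> set E6_list \<and> v \<in> set E6_list \<and>
    edge_theta {(Na, Nb), (Nb, Nc), (Nc, Nd), (Nd, Ne), (Nc, Nf)} (fst u) (fst v) = -1) E6_cover_list"
  by code_simp+

text \<open>Unfolding \<open>theta E6\<close> brings the remaining premises into the form with an
  explicit edge set, in which they were evaluated.\<close>

lemmas E6_heap_plays = legal_list_plays[OF E6_simps E6_cover_list_wf(1),
  unfolded E6_simps(4), OF E6_cover_list_wf(2) E6_legal]

section \<open>Type E7: a linear extension read from the top, with its evaluation\<close>

definition E7_list :: "(E_node \<times> nat) list" where
  "E7_list =
     [(Na, 1), (Nb, 1), (Nc, 1), (Nd, 1), (Ne, 1), (Ng, 1), (Nf, 1), (Nd, 2), (Ne, 2), (Nc, 2),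
      (Nd, 3), (Nb, 2), (Ng, 2), (Nc, 3), (Na, 2), (Nd, 4), (Nb, 3), (Ne, 3), (Nc, 4), (Nf, 2),
      (Nd, 5), (Ne, 4), (Ng, 3), (Nd, 6), (Nc, 5), (Nb, 4), (Na, 3)]"

definition E7_cover_list :: "((E_node \<times> nat) \<times> (E_node \<times> nat)) list" where
  "E7_cover_list =
     [((Na, 1), (Nb, 1)), ((Nb, 1), (Nc, 1)), ((Nc, 1), (Nd, 1)), ((Nd, 1), (Ne, 1)), ((Nd, 1),
      (Ng, 1)), ((Ne, 1), (Nf, 1)), ((Ne, 1), (Nd, 2)), ((Ng, 1), (Nd, 2)), ((Nf, 1), (Ne, 2)),
      ((Nd, 2), (Ne, 2)), ((Nd, 2), (Nc, 2)), ((Ne, 2), (Nd, 3)), ((Nc, 2), (Nd, 3)), ((Nc, 2),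
      (Nb, 2)), ((Nd, 3), (Ng, 2)), ((Nd, 3), (Nc, 3)), ((Nb, 2), (Nc, 3)), ((Nb, 2), (Na, 2)),
      ((Nc, 3), (Nd, 4)), ((Nc, 3), (Nb, 3)), ((Ng, 2), (Nd, 4)), ((Na, 2), (Nb, 3)), ((Nd, 4),
      (Ne, 3)), ((Nd, 4), (Nc, 4)), ((Nb, 3), (Nc, 4)), ((Ne, 3), (Nf, 2)), ((Ne, 3), (Nd, 5)),
      ((Nc, 4), (Nd, 5)), ((Nf, 2), (Ne, 4)), ((Nd, 5), (Ne, 4)), ((Nd, 5), (Ng, 3)), ((Ne, 4),
      (Nd, 6)), ((Ng, 3), (Nd, 6)), ((Nd, 6), (Nc, 5)), ((Nc, 5), (Nb, 4)), ((Nb, 4), (Na, 3))]"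

lemma E7_elems_list: "E7_elems = set E7_list"
  by code_simp

lemma E7_covers_list: "E7_covers = set E7_cover_list"
  by (simp only: E7_covers_def E7_cover_list_def list.set)

lemma E7_simps:
  "elems E7 = set E7_list" "ord E7 = order_of_covers (set E7_list) (set E7_cover_list)"
  "color E7 = fst" "theta E7 = edge_theta {(Na, Nb), (Nb, Nc), (Nc, Nd), (Nd, Ne), (Ne, Nf), (Nd, Ng)}" "colors E7 = set [Na, Nb, Nc, Nd, Ne, Nf, Ng]"
  by (simp_all add: E7_def E7_elems_list E7_covers_list)

lemma E7_legal: "legal_list E7_cover_list fst (edge_theta {(Na, Nb), (Nb, Nc), (Nc, Nd), (Nd, Ne), (Ne, Nf), (Nd, Ng)})
    E7_list [] (map (\<lambda>c. (c, if c = Na then 1 else 0)) [Na, Nb, Nc, Nd, Ne, Nf, Ng])"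
  by code_simp

lemma E7_cover_list_wf:
  "fst ` set E7_list \<subseteq> set [Na, Nb, Nc, Nd, Ne, Nf, Ng]"
  "list_all (\<lambda>(u, v). u \<in> set E7_list \<and> v \<in> set E7_list \<and>
    edge_theta {(Na, Nb), (Nb, Nc), (Nc, Nd), (Nd, Ne), (Ne, Nf), (Nd, Ng)} (fst u) (fst v) = -1) E7_cover_list"
  by code_simp+

lemmas E7_heap_plays = legal_list_plays[OF E7_simps E7_cover_list_wf(1),
  unfolded E7_simps(4), OF E7_cover_list_wf(2) E7_legal]


section \<open>The classification\<close>

context minuscule_game
begin

lemma shaped_A_exterior:
  assumes sh: "shaped e 0 p q" shows "has_type_A_exterior P"
proof -
  have pq: "1 \<le> p" "1 \<le> q" using sh by (auto simp: shaped_def)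
  let ?Q = "A_exterior (p + 1) (p + q + 1)"
  \<comment> \<open>The root receives \<open>p + 1\<close>, the color of the maximum of the
    rectangle. The first branch counts down from there to 1, the second counts up to
    \<open>p + q + 1\<close>.\<close>
  let ?k = "\<lambda>i. if i \<le> p then p + 1 - i else i + 1"
  have n: "p + 1 + (q + 1) - 1 = p + q + 1" by simp
  have "gamma_isomorphic P ?Q"
  proof (rule shaped_isomorphic[OF sh, where k = ?k])
    show "bij_betw ?k {..<0 + p + q + 1} (colors ?Q)"
      by (rule bij_betw_byWitness[where f' = "\<lambda>c. if c \<le> p + 1 then p + 1 - c else c - 1"])
        (auto simp: A_exterior_simps)
    show "theta ?Q (?k i) (?k j) = tree_theta (shape_par 0 p) i j"
      if "i < 0 + p + q + 1" "j < 0 + p + q + 1" for i j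
    proof -
      have "?k i = ?k j \<longleftrightarrow> i = j" using that by auto
      moreover have "1 \<le> ?k i \<and> ?k i \<le> p + q + 1 \<and> 1 \<le> ?k j \<and> ?k j \<le> p + q + 1 \<and>
          (?k j = ?k i + 1 \<or> ?k i = ?k j + 1) \<longleftrightarrow>
        0 < j \<and> shape_par 0 p j = i \<or> 0 < i \<and> shape_par 0 p i = j"
        using that pq by (cases "i \<le> p"; cases "j \<le> p") (simp_all add: shape_par_def, arith+)
      ultimately show ?thesis
        unfolding A_exterior_simps edge_theta_path tree_theta_def by presburger
    qed
    show "heap_poset ?Q" using A_exterior_heap[of "p + 1" "q + 1"] n by simp
    show "plays ?Q (\<lambda>c. if c = ?k 0 then 1 else 0) (elems ?Q) (\<lambda>c. if c = q + 1 then -1 else 0)"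
      using A_exterior_plays[of "p + 1" "q + 1"] n by simp
  qed auto
  then show ?thesis using pq unfolding has_type_A_exterior_def by (intro exI conjI) auto
qed

text \<open>When both branches are single nodes, the numbering of the tree is that of the listed
  diagram shifted by one, with \<open>n = s + 3\<close>.\<close>

lemma shaped_D_standard:
  assumes sh: "shaped e s 1 1" and s: "1 \<le> s" shows "has_type_D_standard P"
proof -
  let ?Q = "D_standard (s + 3)"
  have "gamma_isomorphic P ?Q"
  proof (rule shaped_isomorphic[OF sh, where k = Suc])
    show "bij_betw Suc {..<s + 1 + 1 + 1} (colors ?Q)"
      by (rule bij_betw_byWitness[where f' = "\<lambda>c. c - 1"]) (auto simp: D_standard_simps)
    show "theta ?Q (Suc i) (Suc j) = tree_theta (shape_par s 1) i j"
      if "i < s + 1 + 1 + 1" "j < s + 1 + 1 + 1" for i j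
      using that s unfolding D_standard_simps tree_theta_def shape_par_def by auto
    show "heap_poset ?Q" by (rule D_standard_heap)
    show "plays ?Q (\<lambda>c. if c = Suc 0 then 1 else 0) (elems ?Q) (\<lambda>c. if c = 1 then -1 else 0)"
      using D_standard_plays by simp
  qed auto
  then show ?thesis using s unfolding has_type_D_standard_def by (intro exI[of _ "s + 3"]) auto
qed

lemma shaped_D_spin:
  assumes sh: "shaped e 1 1 q" and q: "2 \<le> q" shows "has_type_D_spin P"
proof -
  let ?Q = "D_spin (q + 3)"
  \<comment> \<open>The root and the one-node branch are the two spin nodes, node 1 is the branching
    node, and the long branch is the rest of the path.\<close>
  let ?k = "\<lambda>i. if i = 0 then C0 else if i = 1 then C 1 else if i = 2 then C0' else C (i - 1)"
  obtain \<mu> where \<mu>: "plays ?Q (\<lambda>c. if c = C0 then 1 else 0) (elems ?Q) \<mu>" "\<And>c. \<mu> c \<le> 0"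
    using D_spin_plays by blast
  have "gamma_isomorphic P ?Q"
  proof (rule shaped_isomorphic[OF sh, where k = ?k])
    show "bij_betw ?k {..<1 + 1 + q + 1} (colors ?Q)"
      by (rule bij_betw_byWitness[where f' = "\<lambda>c. case c of C0 \<Rightarrow> 0 | C0' \<Rightarrow> 2 | C j \<Rightarrow> if j = 1 then 1 else j + 1"])
        (auto simp: D_spin_simps intro!: imageI split: if_splits)
    show "theta ?Q (?k i) (?k j) = tree_theta (shape_par 1 1) i j"
      if "i < 1 + 1 + q + 1" "j < 1 + 1 + q + 1" for i j
    proof -
      have "n = 0 \<or> n = 1 \<or> n = 2 \<or> (\<exists>m. n = m + 3)" for n :: nat by presburger
      from this[of i] this[of j] show ?thesis
        using that by (elim disjE exE) (simp_all add: D_spin_simps tree_theta_def shape_par_def)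
    qed
    show "heap_poset ?Q" by (rule D_spin_heap)
    show "plays ?Q (\<lambda>c. if c = ?k 0 then 1 else 0) (elems ?Q) \<mu>" using \<mu> by simp
  qed (rule \<mu>(2))
  then show ?thesis using q unfolding has_type_D_spin_def by (intro exI[of _ "q + 3"]) auto
qed

lemma shaped_E6:
  assumes sh: "shaped e 2 1 2" shows "has_type_E6 P"
proof -
  \<comment> \<open>The order is stem, short branch, long branch, so \<open>Nf\<close> comes before
    \<open>Nd\<close> and \<open>Ne\<close>.\<close>
  let ?k = "(!) [Na, Nb, Nc, Nf, Nd, Ne]"
  obtain \<mu> where \<mu>: "plays E6 (\<lambda>c. if c = Na then 1 else 0) (elems E6) \<mu>"
    "\<And>c. c \<in> colors E6 \<Longrightarrow> \<mu> c \<le> 0"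
    using E6_heap_plays(2) by blast
  have "\<forall>i\<in>{..<6}. \<forall>j\<in>{..<6}. edge_theta {(Na, Nb), (Nb, Nc), (Nc, Nd), (Nd, Ne), (Nc, Nf)} (?k i) (?k j) =
      tree_theta (shape_par 2 1) i j"
    by code_simp
  moreover have "bij_betw ?k {..<6} (colors E6)"
    by (rule bij_betw_nth) (auto simp: E6_simps)
  ultimately have "gamma_isomorphic P E6"
    by (intro shaped_isomorphic[OF sh, where k = ?k]) (use E6_heap_plays(1) \<mu> in \<open>auto simp: E6_simps(4)\<close>)
  then show ?thesis by (simp add: has_type_E6_def)
qed

lemma shaped_E7:
  assumes sh: "shaped e 3 1 2" shows "has_type_E7 P"
proof -
  let ?k = "(!) [Na, Nb, Nc, Nd, Ng, Ne, Nf]"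
  obtain \<mu> where \<mu>: "plays E7 (\<lambda>c. if c = Na then 1 else 0) (elems E7) \<mu>"
    "\<And>c. c \<in> colors E7 \<Longrightarrow> \<mu> c \<le> 0"
    using E7_heap_plays(2) by blast
  have "\<forall>i\<in>{..<7}. \<forall>j\<in>{..<7}. edge_theta {(Na, Nb), (Nb, Nc), (Nc, Nd), (Nd, Ne), (Ne, Nf), (Nd, Ng)} (?k i) (?k j) =
      tree_theta (shape_par 3 1) i j"
    by code_simp
  moreover have "bij_betw ?k {..<7} (colors E7)"
    by (rule bij_betw_nth) (auto simp: E7_simps)
  ultimately have "gamma_isomorphic P E7"
    by (intro shaped_isomorphic[OF sh, where k = ?k]) (use E7_heap_plays(1) \<mu> in \<open>auto simp: E7_simps(4)\<close>)
  then show ?thesis by (simp add: has_type_E7_def)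
qed

end

theorem theorem7p4:
  fixes P :: "('a, 'c) colored_poset"
  assumes "gamma_colored_minuscule P"
    and "finite (elems P)"
    and "connected_poset P"
    and "simply_laced (colors P) (theta P)"
    and "card (colors P) > 1"
    and "slant_irreducible P"
  shows "has_type_A_exterior P \<or> has_type_D_standard P \<or> has_type_D_spin P \<or>
         has_type_E6 P \<or> has_type_E7 P"
proof -
  interpret minuscule_game P by unfold_locales (fact assms)+
  obtain e s p q where sh: "shaped e s p q" using ex_shaped assms(5,6) by blast
  have "1 \<le> p" "p \<le> q" using sh by (auto simp: shaped_def)
  \<comment> \<open>The triple \<open>s = p = q = 1\<close>, which is D4, is assigned to type D
    standard; this leaves \<open>2 \<le> q\<close> for type D spin.\<close>
  then consider "s = 0" | "1 \<le> s" "p = 1" "q = 1" | "s = 1" "p = 1" "2 \<le> q"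
    | "s = 2" "p = 1" "q = 2" | "s = 3" "p = 1" "q = 2"
    using shaped_cases[OF sh] by linarith
  then show ?thesis
  proof cases
    case 1
    then show ?thesis using shaped_A_exterior sh by blast
  next
    case 2
    then show ?thesis using shaped_D_standard sh by blast
  next
    case 3
    then show ?thesis using shaped_D_spin sh by blast
  next
    case 4
    then show ?thesis using shaped_E6 sh by blast
  next
    case 5
    then show ?thesis using shaped_E7 sh by blast
  qed
qed

end
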